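(* Consider monopolistic cooperation with $n=|N|=|F|$ and let $\hat p=\frac{\alpha p}{n}$. (1) If $c-\gamma\le\frac{\delta}{1-\delta}\,\hat p\,(v-c)$, then the complete network on $N$ is stable and efficient. (2) If $c-\gamma>\frac{\delta}{1-\delta}\,\hat p\,(v-c)$, then the empty network is the unique stable network.
   Context: Networks. $N=\{1,\dots,n\}$ is a finite set of players. A network $g$ is an undirected simple graph on $N$, viewed as its set of links; $N_i(g)=\{j: ij\in g\}$, $d_i(g)=|N_i(g)|$. Parameters: $\alpha\in(0,1]$, $p\in(0,1)$, $\delta\in(0,1)$, $v>c>0$, $\gamma\in[0,c)$. Favor exchange game (monopolistic cooperation). The set of favor types is $F=\{1,\dots,n\}$; player $k$ can provide favor type $k$ with probability $p$ in each period and can never provide any other type. Time is $t=0,1,2,\dots$; $g_t$ is the network at the beginning of period $t$, and $g_0=g$ is common knowledge. In each period: (i) players decide, for each of their links, to keep ($K$) or remove ($R$) it (a link removed by either side disappears permanently); (ii) at most one player requires a favor, each given player requiring one with probability $\alpha$, and its type is uniform on $F$; (iii) it is determined whether the player who can provide that type is able to do so in this period (probability $p$); (iv) if that player $j$ is able and is a current neighbor of the requester $i$, then $j$ chooses $C$ (payoff $v$ to $i$, $-c$ to $j$) or $D$ (payoff $0$ to $i$, $-\gamma$ to $j$). All other payoffs are $0$; discount factor $\delta$. Player $i$ observes with whom she plays, the action profiles in periods in which she plays, and $N_i(g_t)$, but not $g_t$. Equilibrium. A strategy $\sigma_i(h_{t,i},j)$ gives, for each private history $h_{t,i}$ and $j\neq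 i$, a distribution over decisions toward $j$. The bilateral history $h_{t,ij}$ contains only the periods and action profiles of past interactions between $i$ and $j$; $\sigma$ is measurable with respect to bilateral histories if $\sigma_i(h_{t,i},j)=\sigma_i(h'_{t,i},j)$ whenever $h_{t,ij}=h'_{t,ij}$. $(g,\sigma)$ is a bilateral equilibrium if $\sigma$ is measurable with respect to bilateral histories and is part of a sequential equilibrium of the game with $g_0=g$. A network $g$ is stable if there is a bilateral equilibrium $(g,\sigma)$ in which on the equilibrium path all favors are provided and all links are kept. Efficiency. When all favors are provided in network $g$, player $i$'s expected per-period payoff is $u_i(g)=d_i(g)\,\hat p\,(v-c)$. A network is efficient if every player's payoff $u_i$ in it is at least her payoff in any other network on $N$. *)

theory Defs
  imports "HOL-Probability.Probability" "HOL-Probability.Product_PMF"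
begin

section \<open>Networks\<close>

text \<open>A network is its set of links, a link being a two-element set of players.\<close>

type_synonym network = "nat set set"

definition players :: "nat \<Rightarrow> nat set" where
  "players n = {1..n}"

definition complete_network :: "nat \<Rightarrow> network" where
  "complete_network n = {{i, j} |i j. i \<in> players n \<and> j \<in> players n \<and> i \<noteq> j}"

definition is_network :: "nat \<Rightarrow> network \<Rightarrow> bool" where
  "is_network n g \<longleftrightarrow> g \<subseteq> complete_network n"

definition neighbors :: "network \<Rightarrow> nat \<Rightarrow> nat set" where
  "neighbors g i = {j. {i, j} \<in> g}"

definition degree :: "network \<Rightarrow> nat \<Rightarrow> nat" where
  "degree g i = card (neighbors g i)"


section \<open>Histories\<close>

datatype link_act = Keep | Remove

text \<open>The actions \<open>C\<close> and \<open>D\<close> of a player who is asked for a favor and able to provide it.\<close>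

datatype favor_act = Coop | Defect

text \<open>
  Entry \<open>(i, j)\<close> of a link profile is the decision of \<open>i\<close> about her link with \<open>j\<close>; it is
  \<open>Keep\<close> by convention for pairs that are not linked.
\<close>

type_synonym link_profile = "nat \<times> nat \<Rightarrow> link_act"

text \<open>
  Nature's move: \<open>None\<close> if nobody requires a favor; \<open>Some (i, k, b)\<close> if player \<open>i\<close> requires a
  favor of type \<open>k\<close>, where \<open>b\<close> says whether player \<open>k\<close>, the only one who can ever provide
  type \<open>k\<close>, is able to do so in this period.
\<close>

type_synonym demand = "(nat \<times> nat \<times> bool) option"

text \<open>The last component of a period is \<open>None\<close> if nobody was called upon to choose \<open>C\<close> or \<open>D\<close>.\<close>

type_synonym period = "link_profile \<times> demand \<times> favor_act option"

text \<open>Full histories list the completed periods, the most recent one first.\<close>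

type_synonym history = "period list"

definition after_removal :: "network \<Rightarrow> link_profile \<Rightarrow> network" where
  "after_removal g d = g - {{i, j} |i j. d (i, j) = Remove}"

text \<open>The pair (requester, provider) of the interaction taking place in network \<open>g\<close>, if any.\<close>

definition meeting :: "network \<Rightarrow> demand \<Rightarrow> (nat \<times> nat) option" where
  "meeting g \<omega> = (case \<omega> of None \<Rightarrow> None
     | Some (i, k, able) \<Rightarrow> if able \<and> {i, k} \<in> g then Some (i, k) else None)"

text \<open>The network \<open>g\<^sub>t\<close> at the beginning of the period following the history, starting from \<open>g\<^sub>0 = g\<close>.\<close>

fun net :: "network \<Rightarrow> history \<Rightarrow> network" where
  "net g [] = g"
| "net g ((d, \<omega>, a) # h) = after_removal (net g h) d"

text \<open>
  What player \<open>i\<close> learns in a period: her neighborhood at its beginning, her own link decisions,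
  and the requester, provider and action of the interaction if she took part in one.
\<close>

type_synonym private_period = "nat set \<times> (nat \<Rightarrow> link_act) \<times> (nat \<times> nat \<times> favor_act) option"

text \<open>Her current neighborhood is the second component of a private history.\<close>

type_synonym private_history = "private_period list \<times> nat set"

definition own_links :: "nat \<Rightarrow> link_profile \<Rightarrow> nat \<Rightarrow> link_act" where
  "own_links i d = (\<lambda>j. d (i, j))"

definition observed :: "nat \<Rightarrow> (nat \<times> nat) option \<Rightarrow> favor_act option \<Rightarrow>
    (nat \<times> nat \<times> favor_act) option" where
  "observed i m a = (case (m, a) of
       (Some (r, s), Some x) \<Rightarrow> if i = r \<or> i = s then Some (r, s, x) else None
     | _ \<Rightarrow> None)"

fun past_view :: "network \<Rightarrow> nat \<Rightarrow> history \<Rightarrow> private_period list" where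
  "past_view g i [] = []"
| "past_view g i ((d, \<omega>, a) # h) =
     (neighbors (net g h) i, own_links i d,
      observed i (meeting (after_removal (net g h) d) \<omega>) a) # past_view g i h"

definition private_hist :: "network \<Rightarrow> nat \<Rightarrow> history \<Rightarrow> private_history" where
  "private_hist g i h = (past_view g i h, neighbors (net g h) i)"

text \<open>
  The bilateral history has one entry per past period, which is \<open>None\<close> unless \<open>i\<close> and \<open>j\<close>
  interacted in that period; so it records exactly the periods and actions of their
  interactions. Link decisions and other interactions are not part of it.
\<close>

definition bilateral_hist :: "nat \<Rightarrow> nat \<Rightarrow> private_history \<Rightarrow>
    (nat \<times> nat \<times> favor_act) option list" where
  "bilateral_hist i j x = map (\<lambda>(_, _, e). case e of None \<Rightarrow> None
      | Some (r, s, y) \<Rightarrow> if {r, s} = {i, j} then Some (r, s, y) else None) (fst x)"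


section \<open>Strategies\<close>

text \<open>
  \<open>link_dec \<sigma> x j\<close> is the distribution over keeping and removing the link with \<open>j\<close> at the
  private history \<open>x\<close>. \<open>favor_dec \<sigma> x y j\<close> is the distribution over \<open>C\<close> and \<open>D\<close> towards the
  requester \<open>j\<close>, at the later stage of the same period; \<open>y\<close> are the link decisions the
  player has just taken. The values at information sets that cannot occur are irrelevant.
\<close>

record strategy =
  link_dec :: "private_history \<Rightarrow> nat \<Rightarrow> link_act pmf"
  favor_dec :: "private_history \<Rightarrow> (nat \<Rightarrow> link_act) \<Rightarrow> nat \<Rightarrow> favor_act pmf"

type_synonym profile = "nat \<Rightarrow> strategy"

text \<open>Nodes of the favor stage: history, link decisions of the current period, nature's move.\<close>

type_synonym interim_node = "history \<times> link_profile \<times> demand"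

text \<open>
  Beliefs of each player over the nodes of her information sets, at the link stage and
  at the favor stage; arguments as for strategies.
\<close>

record beliefs =
  link_belief :: "nat \<Rightarrow> private_history \<Rightarrow> history pmf"
  favor_belief :: "nat \<Rightarrow> private_history \<Rightarrow> (nat \<Rightarrow> link_act) \<Rightarrow> nat \<Rightarrow> interim_node pmf"

definition link_info_set :: "network \<Rightarrow> nat \<Rightarrow> private_history \<Rightarrow> history set" where
  "link_info_set g i x = {h. private_hist g i h = x}"

definition favor_info_set :: "network \<Rightarrow> nat \<Rightarrow> private_history \<Rightarrow> (nat \<Rightarrow> link_act) \<Rightarrow> nat \<Rightarrow>
    interim_node set" where
  "favor_info_set g i x y j = {(h, d, \<omega>). private_hist g i h = x \<and> own_links i d = y \<and>
     meeting (after_removal (net g h) d) \<omega> = Some (j, i)}"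

text \<open>The links decided upon at a history are randomized independently of each other.\<close>

definition link_stage :: "profile \<Rightarrow> network \<Rightarrow> history \<Rightarrow> link_profile pmf" where
  "link_stage \<sigma> g h = Pi_pmf {(i, j). {i, j} \<in> net g h} Keep
     (\<lambda>(i, j). link_dec (\<sigma> i) (private_hist g i h) j)"

definition favor_stage :: "profile \<Rightarrow> network \<Rightarrow> interim_node \<Rightarrow> history pmf" where
  "favor_stage \<sigma> g = (\<lambda>(h, d, \<omega>).
     case meeting (after_removal (net g h) d) \<omega> of
       None \<Rightarrow> return_pmf ((d, \<omega>, None) # h)
     | Some (r, s) \<Rightarrow> map_pmf (\<lambda>a. (d, \<omega>, Some a) # h)
         (favor_dec (\<sigma> s) (private_hist g s h) (own_links s d) r))"


section \<open>The game with monopolistic cooperation\<close>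

locale favor_exchange =
  fixes n :: nat and \<alpha> p \<delta> v c \<gamma> :: real
begin

text \<open>
  Each player is the requester with probability \<open>(n * \<alpha>) * (1 / n) = \<alpha>\<close>, and at most one is;
  this presupposes \<open>n * \<alpha> \<le> 1\<close>. Favor types are identified with their providers.
\<close>

definition nature :: "demand pmf" where
  "nature = do {
     required \<leftarrow> bernoulli_pmf (real n * \<alpha>);
     if required then do {
       i \<leftarrow> pmf_of_set (players n);
       k \<leftarrow> pmf_of_set (players n);
       able \<leftarrow> bernoulli_pmf p;
       return_pmf (Some (i, k, able))
     } else return_pmf None
   }"

definition payoff :: "nat \<Rightarrow> (nat \<times> nat) option \<Rightarrow> favor_act option \<Rightarrow> real" where
  "payoff i m a = (case (m, a) of
       (Some (r, s), Some Coop) \<Rightarrow> if i = r then v else if i = s then - c else 0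
     | (Some (r, s), Some Defect) \<Rightarrow> if i = s then - \<gamma> else 0
     | _ \<Rightarrow> 0)"

text \<open>The payoff in the most recent period of a history.\<close>

fun last_payoff :: "network \<Rightarrow> nat \<Rightarrow> history \<Rightarrow> real" where
  "last_payoff g i [] = 0"
| "last_payoff g i ((d, \<omega>, a) # h) = payoff i (meeting (after_removal (net g h) d) \<omega>) a"

definition interim_stage :: "profile \<Rightarrow> network \<Rightarrow> history \<Rightarrow> interim_node pmf" where
  "interim_stage \<sigma> g h = do {
     d \<leftarrow> link_stage \<sigma> g h;
     \<omega> \<leftarrow> nature;
     return_pmf (h, d, \<omega>)
   }"

definition play_period :: "profile \<Rightarrow> network \<Rightarrow> history \<Rightarrow> history pmf" where
  "play_period \<sigma> g h = bind_pmf (interim_stage \<sigma> g h) (favor_stage \<sigma> g)"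

fun run :: "profile \<Rightarrow> network \<Rightarrow> nat \<Rightarrow> history \<Rightarrow> history pmf" where
  "run \<sigma> g 0 h = return_pmf h"
| "run \<sigma> g (Suc t) h = bind_pmf (run \<sigma> g t h) (play_period \<sigma> g)"

definition interim_run :: "profile \<Rightarrow> network \<Rightarrow> nat \<Rightarrow> interim_node pmf" where
  "interim_run \<sigma> g t = bind_pmf (run \<sigma> g t []) (interim_stage \<sigma> g)"

text \<open>The nodes of the game tree, excluding those that nature rules out.\<close>

definition link_nodes :: "network \<Rightarrow> nat \<Rightarrow> history set" where
  "link_nodes g t = (\<Union>\<sigma>. set_pmf (run \<sigma> g t []))"

definition interim_nodes :: "network \<Rightarrow> nat \<Rightarrow> interim_node set" where
  "interim_nodes g t = (\<Union>\<sigma>. set_pmf (interim_run \<sigma> g t))"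

text \<open>
  Expected payoff of \<open>i\<close> from the current period on, discounted to the current period, where
  \<open>Q\<close> is the distribution of the history at the end of the current period and \<open>\<sigma>\<close> is played
  thereafter.
\<close>

definition discounted_payoff :: "profile \<Rightarrow> network \<Rightarrow> nat \<Rightarrow> history pmf \<Rightarrow> real" where
  "discounted_payoff \<sigma> g i Q =
     (\<Sum>s. \<delta> ^ s * measure_pmf.expectation (bind_pmf Q (run \<sigma> g s)) (last_payoff g i))"

definition link_payoff :: "profile \<Rightarrow> network \<Rightarrow> nat \<Rightarrow> history pmf \<Rightarrow> real" where
  "link_payoff \<sigma> g i B = discounted_payoff \<sigma> g i (bind_pmf B (play_period \<sigma> g))"

definition favor_payoff :: "profile \<Rightarrow> network \<Rightarrow> nat \<Rightarrow> interim_node pmf \<Rightarrow> real" where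
  "favor_payoff \<sigma> g i B = discounted_payoff \<sigma> g i (bind_pmf B (favor_stage \<sigma> g))"


subsection \<open>Sequential equilibrium\<close>

definition sequentially_rational :: "network \<Rightarrow> profile \<Rightarrow> beliefs \<Rightarrow> bool" where
  "sequentially_rational g \<sigma> \<mu> \<longleftrightarrow>
     (\<forall>t. \<forall>h \<in> link_nodes g t. \<forall>i \<in> players n. \<forall>\<tau>.
        let B = link_belief \<mu> i (private_hist g i h)
        in link_payoff (\<sigma>(i := \<tau>)) g i B \<le> link_payoff \<sigma> g i B) \<and>
     (\<forall>t. \<forall>(h, d, \<omega>) \<in> interim_nodes g t. \<forall>i j \<tau>.
        meeting (after_removal (net g h) d) \<omega> = Some (j, i) \<longrightarrow>
        (let B = favor_belief \<mu> i (private_hist g i h) (own_links i d) j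
         in favor_payoff (\<sigma>(i := \<tau>)) g i B \<le> favor_payoff \<sigma> g i B))"

definition completely_mixed :: "profile \<Rightarrow> bool" where
  "completely_mixed \<sigma> \<longleftrightarrow> (\<forall>i \<in> players n. \<forall>x y j.
     set_pmf (link_dec (\<sigma> i) x j) = UNIV \<and> set_pmf (favor_dec (\<sigma> i) x y j) = UNIV)"

definition profile_limit :: "(nat \<Rightarrow> profile) \<Rightarrow> profile \<Rightarrow> bool" where
  "profile_limit S \<sigma> \<longleftrightarrow> (\<forall>i \<in> players n. \<forall>x y j.
     (\<forall>a. (\<lambda>m. pmf (link_dec (S m i) x j) a) \<longlonglongrightarrow> pmf (link_dec (\<sigma> i) x j) a) \<and>
     (\<forall>a. (\<lambda>m. pmf (favor_dec (S m i) x y j) a) \<longlonglongrightarrow> pmf (favor_dec (\<sigma> i) x y j) a))"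

text \<open>
  Beliefs derived by Bayes' rule. For a completely mixed profile, every information set
  that can occur has positive probability, so that \<open>cond_pmf\<close> is meaningful there. The
  length of the private history is the number of the period.
\<close>

definition bayes_beliefs :: "network \<Rightarrow> profile \<Rightarrow> beliefs" where
  "bayes_beliefs g \<sigma> = \<lparr>
     link_belief = (\<lambda>i x. cond_pmf (run \<sigma> g (length (fst x)) []) (link_info_set g i x)),
     favor_belief = (\<lambda>i x y j.
       cond_pmf (interim_run \<sigma> g (length (fst x))) (favor_info_set g i x y j)) \<rparr>"

definition beliefs_limit :: "network \<Rightarrow> (nat \<Rightarrow> beliefs) \<Rightarrow> beliefs \<Rightarrow> bool" where
  "beliefs_limit g M \<mu> \<longleftrightarrow>
     (\<forall>t. \<forall>h \<in> link_nodes g t. \<forall>i \<in> players n. let x = private_hist g i h in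
        \<forall>z. (\<lambda>m. pmf (link_belief (M m) i x) z) \<longlonglongrightarrow> pmf (link_belief \<mu> i x) z) \<and>
     (\<forall>t. \<forall>(h, d, \<omega>) \<in> interim_nodes g t. \<forall>i j.
        meeting (after_removal (net g h) d) \<omega> = Some (j, i) \<longrightarrow>
        (let x = private_hist g i h; y = own_links i d in
        \<forall>z. (\<lambda>m. pmf (favor_belief (M m) i x y j) z) \<longlonglongrightarrow> pmf (favor_belief \<mu> i x y j) z))"

definition consistent :: "network \<Rightarrow> profile \<Rightarrow> beliefs \<Rightarrow> bool" where
  "consistent g \<sigma> \<mu> \<longleftrightarrow> (\<exists>S. (\<forall>m. completely_mixed (S m)) \<and> profile_limit S \<sigma> \<and>
     beliefs_limit g (\<lambda>m. bayes_beliefs g (S m)) \<mu>)"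

definition sequential_equilibrium :: "network \<Rightarrow> profile \<Rightarrow> beliefs \<Rightarrow> bool" where
  "sequential_equilibrium g \<sigma> \<mu> \<longleftrightarrow> sequentially_rational g \<sigma> \<mu> \<and> consistent g \<sigma> \<mu>"


subsection \<open>Stability and efficiency\<close>

definition bilaterally_measurable :: "profile \<Rightarrow> bool" where
  "bilaterally_measurable \<sigma> \<longleftrightarrow> (\<forall>i \<in> players n. \<forall>j \<in> players n. i \<noteq> j \<longrightarrow>
     (\<forall>x x'. bilateral_hist i j x = bilateral_hist i j x' \<longrightarrow>
        link_dec (\<sigma> i) x j = link_dec (\<sigma> i) x' j \<and>
        (\<forall>y y'. favor_dec (\<sigma> i) x y j = favor_dec (\<sigma> i) x' y' j)))"

definition bilateral_equilibrium :: "network \<Rightarrow> profile \<Rightarrow> bool" where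
  "bilateral_equilibrium g \<sigma> \<longleftrightarrow>
     bilaterally_measurable \<sigma> \<and> (\<exists>\<mu>. sequential_equilibrium g \<sigma> \<mu>)"

definition cooperative_path :: "network \<Rightarrow> profile \<Rightarrow> bool" where
  "cooperative_path g \<sigma> \<longleftrightarrow> (\<forall>t. \<forall>h \<in> set_pmf (run \<sigma> g t []). \<forall>(d, \<omega>, a) \<in> set h.
     (\<forall>i j. d (i, j) = Keep) \<and> a \<noteq> Some Defect)"

definition stable :: "network \<Rightarrow> bool" where
  "stable g \<longleftrightarrow> is_network n g \<and> (\<exists>\<sigma>. bilateral_equilibrium g \<sigma> \<and> cooperative_path g \<sigma>)"

definition phat :: real where
  "phat = \<alpha> * p / real n"

definition period_payoff :: "nat \<Rightarrow> network \<Rightarrow> real" where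
  "period_payoff i g = real (degree g i) * phat * (v - c)"

definition efficient :: "network \<Rightarrow> bool" where
  "efficient g \<longleftrightarrow> is_network n g \<and>
     (\<forall>g'. is_network n g' \<longrightarrow> (\<forall>i \<in> players n. period_payoff i g' \<le> period_payoff i g))"

lemma expectation_nature:
  assumes "n \<ge> 1" "0 \<le> \<alpha>" "real n * \<alpha> \<le> 1" "0 \<le> p" "p \<le> 1"
    and none: "\<And>i k. f (Some (i, k, False)) = 0" "f None = (0::real)"
  shows "measure_pmf.expectation nature f =
    \<alpha> * p / real n * (\<Sum>i\<in>players n. \<Sum>k\<in>players n. f (Some (i, k, True)))"
proof -
  have fin: "finite (players n)" and ne: "players n \<noteq> {}" and card: "card (players n) = n"
    using assms(1) by (auto simp: players_def)
  have inner: "measure_pmf.expectation (bernoulli_pmf p \<bind> (\<lambda>able. return_pmf (Some (i, k, able)))) f =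
      p * f (Some (i, k, True))" for i k
    using assms by (subst pmf_expectation_bind[where A = UNIV]) (auto simp: UNIV_bool)
  have mid: "measure_pmf.expectation (pmf_of_set (players n) \<bind> (\<lambda>k.
        bernoulli_pmf p \<bind> (\<lambda>able. return_pmf (Some (i, k, able))))) f =
      (\<Sum>k\<in>players n. p * f (Some (i, k, True)) / real n)" for i
    by (subst pmf_expectation_bind[OF fin])
       (auto simp: fin ne card inner intro: finite_subset[OF subset_UNIV])
  have outer: "measure_pmf.expectation (pmf_of_set (players n) \<bind> (\<lambda>i. pmf_of_set (players n) \<bind> (\<lambda>k.
        bernoulli_pmf p \<bind> (\<lambda>able. return_pmf (Some (i, k, able)))))) f =
      (\<Sum>i\<in>players n. (\<Sum>k\<in>players n. p * f (Some (i, k, True)) / real n) / real n)"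
    by (subst pmf_expectation_bind[OF fin])
       (auto simp: fin ne card mid intro: finite_subset[OF subset_UNIV])
  have "measure_pmf.expectation nature f = real n * \<alpha> *
      (\<Sum>i\<in>players n. (\<Sum>k\<in>players n. p * f (Some (i, k, True)) / real n) / real n)"
    unfolding nature_def using assms
    by (subst pmf_expectation_bind[where A = UNIV])
       (auto simp: UNIV_bool outer fin ne)
  also have "\<dots> = \<alpha> * p / real n * (\<Sum>i\<in>players n. \<Sum>k\<in>players n. f (Some (i, k, True)))"
    using assms(1) by (simp add: sum_distrib_left sum_divide_distrib field_simps)
  finally show ?thesis .
qed

lemma expected_payoff_all_favors_provided:
  assumes "n \<ge> 1" "0 \<le> \<alpha>" "real n * \<alpha> \<le> 1" "0 \<le> p" "p \<le> 1"
    and g: "is_network n g" and i: "i \<in> players n"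
  shows "measure_pmf.expectation nature (\<lambda>\<omega>. payoff i (meeting g \<omega>) (Some Coop)) = period_payoff i g"
proof -
  have fin: "finite (players n)" by (simp add: players_def)
  have noloop: "{i} \<notin> g" for i
    using g unfolding is_network_def complete_network_def by (auto simp: doubleton_eq_iff)
  have nb: "players n \<inter> neighbors g i = neighbors g i"
    using g unfolding is_network_def complete_network_def neighbors_def
    by (auto simp: doubleton_eq_iff)
  have pay: "payoff i (meeting g (Some (r, k, True))) (Some Coop) =
      (if r = i then if k \<in> neighbors g i then v else 0 else 0) -
      (if k = i then if r \<in> neighbors g i then c else 0 else 0)" for r k
    using noloop by (auto simp: payoff_def meeting_def neighbors_def insert_commute)
  have "(\<Sum>r\<in>players n. \<Sum>k\<in>players n. payoff i (meeting g (Some (r, k, True))) (Some Coop)) =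
      (\<Sum>r\<in>players n. \<Sum>k\<in>players n. if r = i then if k \<in> neighbors g i then v else 0 else 0) -
      (\<Sum>r\<in>players n. \<Sum>k\<in>players n. if k = i then if r \<in> neighbors g i then c else 0 else 0)"
    by (simp only: pay sum_subtractf)
  also have "(\<Sum>r\<in>players n. \<Sum>k\<in>players n. if r = i then if k \<in> neighbors g i then v else 0 else 0) =
      (\<Sum>k\<in>players n. if k \<in> neighbors g i then v else 0)"
    using fin i by (subst sum.swap) simp
  also have "\<dots> = real (degree g i) * v"
    using fin nb by (simp add: sum.inter_restrict[symmetric] degree_def)
  also have "(\<Sum>r\<in>players n. \<Sum>k\<in>players n. if k = i then if r \<in> neighbors g i then c else 0 else 0) =
      (\<Sum>r\<in>players n. if r \<in> neighbors g i then c else 0)"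
    using fin i by simp
  also have "\<dots> = real (degree g i) * c"
    using fin nb by (simp add: sum.inter_restrict[symmetric] degree_def)
  finally have total: "(\<Sum>r\<in>players n. \<Sum>k\<in>players n.
      payoff i (meeting g (Some (r, k, True))) (Some Coop)) = real (degree g i) * (v - c)"
    by (simp add: algebra_simps)
  show ?thesis
    by (subst expectation_nature)
       (use assms in \<open>simp_all add: total, simp_all add: payoff_def meeting_def period_payoff_def phat_def\<close>)
qed

end

end

theory Submission
  imports Defs "HOL-Library.Diagonal_Subsequence"
begin

text \<open>
  A link is worth \<open>V = phat (v - c) / (1 - \<delta>)\<close> to a player as long as both ends cooperate on it, so
  conceding \<open>c - \<gamma>\<close> to keep it is worthwhile iff \<open>c - \<gamma> \<le> \<delta> V\<close>.

  If this holds, let every player keep and cooperate on a link as long as nobody has defected on it, and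
  remove and defect on it afterwards. Then \<open>V\<close> times the number of defection-free links of \<open>i\<close> is an
  upper bound for what \<open>i\<close> can get after \<^emph>\<open>every\<close> history, attained by this strategy; optimality
  therefore holds whatever the beliefs are, and any consistent beliefs will do. Those exist by
  compactness.

  Conversely, let all favors be provided on the path of a bilateral equilibrium on a nonempty network.
  Every defection-free bilateral history of a linked pair occurs on the path, so by measurability
  the pair cooperates after it also off the path. A player asked for a favor in period 0 can
  therefore defect, drop that link, and keep the full value of all her other links; hence
  \<open>c - \<gamma> \<le> \<delta> V\<close>.
\<close>

section \<open>Finitely supported distributions\<close>

lemma UNIV_link_act: "UNIV = {Keep, Remove}"
  by (auto intro: link_act.exhaust)

lemma UNIV_favor_act: "UNIV = {Coop, Defect}"
  by (auto intro: favor_act.exhaust)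

lemma finite_link_act [simp]: "finite (A :: link_act set)"
  by (rule finite_subset[OF subset_UNIV]) (simp add: UNIV_link_act)

lemma finite_favor_act [simp]: "finite (A :: favor_act set)"
  by (rule finite_subset[OF subset_UNIV]) (simp add: UNIV_favor_act)

lemma expectation_bind_finite:
  fixes f :: "'b \<Rightarrow> real"
  assumes "finite (set_pmf P)" and "\<And>x. x \<in> set_pmf P \<Longrightarrow> finite (set_pmf (K x))"
  shows "measure_pmf.expectation (bind_pmf P K) f =
    measure_pmf.expectation P (\<lambda>x. measure_pmf.expectation (K x) f)"
  using assms by (simp add: pmf_expectation_bind[where A = "set_pmf P"]
      integral_measure_pmf[where A = "set_pmf P"])

lemma expectation_mono_finite:
  fixes f h :: "'a \<Rightarrow> real"
  assumes "finite (set_pmf P)" and "\<And>x. x \<in> set_pmf P \<Longrightarrow> f x \<le> h x"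
  shows "measure_pmf.expectation P f \<le> measure_pmf.expectation P h"
  using assms by (intro integral_mono_AE) (auto simp: AE_measure_pmf_iff integrable_measure_pmf_finite)

lemma expectation_cong_pmf:
  fixes f h :: "'a \<Rightarrow> real"
  assumes "\<And>x. x \<in> set_pmf P \<Longrightarrow> f x = h x"
  shows "measure_pmf.expectation P f = measure_pmf.expectation P h"
  using assms by (intro integral_cong_AE) (auto simp: AE_measure_pmf_iff)

lemma expectation_le_const:
  fixes f :: "'a \<Rightarrow> real"
  assumes "finite (set_pmf P)" and "\<And>x. x \<in> set_pmf P \<Longrightarrow> f x \<le> K"
  shows "measure_pmf.expectation P f \<le> K"
  using expectation_mono_finite[OF assms] by simp

lemma abs_expectation_le:
  fixes f :: "'a \<Rightarrow> real"
  assumes "finite (set_pmf P)" and "\<And>x. \<bar>f x\<bar> \<le> K"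
  shows "\<bar>measure_pmf.expectation P f\<bar> \<le> K"
proof -
  have "measure_pmf.expectation P f \<le> K"
    using assms by (intro expectation_le_const) (auto simp: abs_le_iff)
  moreover have "measure_pmf.expectation P (\<lambda>x. - f x) \<le> K"
    using assms by (intro expectation_le_const) (auto simp: abs_le_iff)
  ultimately show ?thesis by (simp add: abs_le_iff)
qed

section \<open>Compactness for families of finitely supported distributions\<close>

text \<open>All mass stays in one fixed finite set, so none can escape in the limit: the pointwise
  limits still sum to 1 and define a distribution.\<close>

lemma pmf_limit_exists:
  assumes "finite A" and sub: "\<And>m. set_pmf (P m) \<subseteq> A"
    and lim: "\<And>z. z \<in> A \<Longrightarrow> (\<lambda>m. pmf (P m) z) \<longlonglongrightarrow> l z"
  obtains Q where "set_pmf Q \<subseteq> A" and "\<And>z. (\<lambda>m. pmf (P m) z) \<longlonglongrightarrow> pmf Q z"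
proof -
  define f where "f z = (if z \<in> A then l z else 0)" for z
  have f_lim: "(\<lambda>m. pmf (P m) z) \<longlonglongrightarrow> f z" for z
  proof (cases "z \<in> A")
    case False
    then have "pmf (P m) z = 0" for m
      using sub by (auto simp: pmf_eq_0_set_pmf)
    then show ?thesis using False by (simp add: f_def)
  qed (simp add: f_def lim)
  have nonneg: "0 \<le> f z" for z
    using f_lim by (rule LIMSEQ_le_const) auto
  have "(\<lambda>m. \<Sum>z\<in>A. pmf (P m) z) \<longlonglongrightarrow> (\<Sum>z\<in>A. f z)"
    by (intro tendsto_sum f_lim)
  moreover have "(\<Sum>z\<in>A. pmf (P m) z) = 1" for m
    using \<open>finite A\<close> sub by (rule sum_pmf_eq_1)
  ultimately have "(\<Sum>z\<in>A. f z) = 1"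
    by (simp add: LIMSEQ_const_iff)
  then have total: "(\<integral>\<^sup>+x. ennreal (f x) \<partial>count_space UNIV) = 1"
    using \<open>finite A\<close> nonneg
    by (subst nn_integral_count_space'[where A = A]) (simp_all add: sum_ennreal, simp add: f_def)
  show thesis
  proof
    show "set_pmf (embed_pmf f) \<subseteq> A"
      by (auto simp: set_embed_pmf[OF nonneg total]) (simp add: f_def split: if_splits)
    show "(\<lambda>m. pmf (P m) z) \<longlonglongrightarrow> pmf (embed_pmf f) z" for z
      using f_lim by (simp add: pmf_embed_pmf[OF nonneg total])
  qed
qed

text \<open>Bolzano-Weierstrass in each coordinate, combined with Cantor's diagonal extraction along
  an enumeration of \<open>K\<close>.\<close>

lemma countable_convergent_subsequence:
  fixes f :: "nat \<Rightarrow> 'k \<Rightarrow> real"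
  assumes "countable K" and bdd: "\<And>m k. f m k \<in> {0..1}"
  obtains r :: "nat \<Rightarrow> nat" where "strict_mono r" and "\<And>k. k \<in> K \<Longrightarrow> convergent (\<lambda>m. f (r m) k)"
proof -
  let ?P = "\<lambda>j s. convergent (\<lambda>m. f (s m) (from_nat_into K j))"
  interpret subseqs ?P
  proof
    fix j :: nat and s :: "nat \<Rightarrow> nat"
    have "seq_compact {0..1 :: real}"
      by (rule compact_imp_seq_compact) simp
    then obtain l r where "strict_mono r" and "((\<lambda>m. f (s m) (from_nat_into K j)) \<circ> r) \<longlonglongrightarrow> l"
      by (rule seq_compactE[where f = "\<lambda>m. f (s m) (from_nat_into K j)"]) (use bdd in blast)+
    then show "\<exists>r. strict_mono r \<and> ?P j (s \<circ> r)"
      by (auto simp: convergent_def o_def)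
  qed
  have "?P j diagseq" for j
  proof -
    \<comment> \<open>Only from index \<open>Suc j\<close> on is the diagonal sequence known to run
      inside the \<open>j\<close>-th extraction; the initial segment does not affect
      convergence.\<close>
    have "?P j (diagseq \<circ> (+) (Suc j))"
    proof (rule diagseq_holds)
      fix r s :: "nat \<Rightarrow> nat" and k :: nat
      assume "strict_mono r" and "?P k s"
      from convergent_subseq_convergent[OF this(2) this(1)] show "?P k (s \<circ> r)"
        by (simp add: o_def)
    qed
    then have "convergent (\<lambda>m. f (diagseq (m + Suc j)) (from_nat_into K j))"
      by (simp add: o_def add.commute)
    then show ?thesis
      using convergent_ignore_initial_segment[of "\<lambda>m. f (diagseq m) (from_nat_into K j)" "Suc j"]
      by simp
  qed
  then show thesis
    using that[OF subseq_diagseq] from_nat_into_surj[OF \<open>countable K\<close>] by metis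
qed

text \<open>The pairs of an index \<open>k\<close> and a point of the finite set \<open>A k\<close>
  form countably many coordinates, so a single subsequence serves the whole family. This is how
  beliefs at all information sets are made to converge simultaneously.\<close>

lemma pmf_family_convergent_subsequence:
  fixes P :: "nat \<Rightarrow> 'k \<Rightarrow> 'a pmf"
  assumes "countable K" and fin: "\<And>k. k \<in> K \<Longrightarrow> finite (A k)"
    and sub: "\<And>m k. k \<in> K \<Longrightarrow> set_pmf (P m k) \<subseteq> A k"
  obtains r :: "nat \<Rightarrow> nat" and Q where "strict_mono r"
    and "\<And>k. k \<in> K \<Longrightarrow> set_pmf (Q k) \<subseteq> A k"
    and "\<And>k z. k \<in> K \<Longrightarrow> (\<lambda>m. pmf (P (r m) k) z) \<longlonglongrightarrow> pmf (Q k) z"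
proof -
  have "countable (Sigma K A)"
    using \<open>countable K\<close> countable_finite[OF fin] by (rule countable_SIGMA)
  then obtain r where r: "strict_mono (r :: nat \<Rightarrow> nat)"
    and conv: "\<And>q. q \<in> Sigma K A \<Longrightarrow> convergent (\<lambda>m. pmf (P (r m) (fst q)) (snd q))"
    using countable_convergent_subsequence[of "Sigma K A" "\<lambda>m q. pmf (P m (fst q)) (snd q)"]
    by (auto simp: pmf_le_1)
  have "\<exists>Q. set_pmf Q \<subseteq> A k \<and> (\<forall>z. (\<lambda>m. pmf (P (r m) k) z) \<longlonglongrightarrow> pmf Q z)" if "k \<in> K" for k
  proof -
    have "(\<lambda>m. pmf (P (r m) k) z) \<longlonglongrightarrow> lim (\<lambda>m. pmf (P (r m) k) z)" if "z \<in> A k" for z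
      using conv[of "(k, z)"] \<open>k \<in> K\<close> that by (simp add: convergent_LIMSEQ_iff)
    from pmf_limit_exists[OF fin[OF that] sub[OF that] this] show ?thesis
      by metis
  qed
  then obtain Q where "\<forall>k\<in>K. set_pmf (Q k) \<subseteq> A k \<and> (\<forall>z. (\<lambda>m. pmf (P (r m) k) z) \<longlonglongrightarrow> pmf (Q k) z)"
    by metis
  with r that show thesis by blast
qed

section \<open>Discounted sums controlled by one-step inequalities\<close>

lemma summable_discounted:
  fixes e :: "nat \<Rightarrow> real"
  assumes "0 < \<delta>" "\<delta> < 1" and e: "\<And>s. \<bar>e s\<bar> \<le> C"
  shows "summable (\<lambda>s. \<delta> ^ s * e s)"
proof (rule summable_comparison_test')
  show "summable (\<lambda>s. \<delta> ^ s * C)"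
    using assms by (intro summable_mult2 summable_geometric) auto
  show "norm (\<delta> ^ s * e s) \<le> \<delta> ^ s * C" for s
    using e[of s] \<open>0 < \<delta>\<close> by (simp add: abs_mult)
qed

text \<open>Here \<open>w s\<close> plays the role of a bound on the payoffs after date
  \<open>s\<close>. Replacing it repeatedly through \<open>step\<close> lets one truncate at any
  date \<open>T\<close> with remainder \<open>\<delta> ^ Suc T * w T\<close>, which vanishes because
  \<open>w\<close> is bounded.\<close>

lemma discounted_sum_le:
  fixes e w :: "nat \<Rightarrow> real"
  assumes "0 < \<delta>" "\<delta> < 1" and e: "\<And>s. \<bar>e s\<bar> \<le> C" and w: "\<And>s. \<bar>w s\<bar> \<le> D"
    and step: "\<And>s. e (Suc s) + \<delta> * w (Suc s) \<le> w s"
  shows "(\<Sum>s. \<delta> ^ s * e s) \<le> e 0 + \<delta> * w 0"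
proof -
  have partial: "(\<Sum>s<Suc T. \<delta> ^ s * e s) + \<delta> ^ Suc T * w T \<le> e 0 + \<delta> * w 0" for T
  proof (induction T)
    case (Suc T)
    have "\<delta> ^ Suc T * (e (Suc T) + \<delta> * w (Suc T)) \<le> \<delta> ^ Suc T * w T"
      using step \<open>0 < \<delta>\<close> by (intro mult_left_mono) auto
    with Suc show ?case by (simp add: algebra_simps)
  qed simp
  have "(\<lambda>T. \<Sum>s<Suc T. \<delta> ^ s * e s) \<longlonglongrightarrow> (\<Sum>s. \<delta> ^ s * e s)"
    by (rule LIMSEQ_Suc[OF summable_LIMSEQ[OF summable_discounted[OF assms(1,2) e]]])
  moreover have "(\<lambda>T. \<delta> ^ Suc T * w T) \<longlonglongrightarrow> 0"
  proof (rule Lim_null_comparison)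
    show "\<forall>\<^sub>F T in sequentially. norm (\<delta> ^ Suc T * w T) \<le> \<delta> ^ Suc T * D"
      using w \<open>0 < \<delta>\<close> by (auto simp: abs_mult intro!: always_eventually mult_left_mono)
    show "(\<lambda>T. \<delta> ^ Suc T * D) \<longlonglongrightarrow> 0"
      using assms by (intro tendsto_mult_left_zero LIMSEQ_Suc LIMSEQ_power_zero) auto
  qed
  ultimately have "(\<lambda>T. (\<Sum>s<Suc T. \<delta> ^ s * e s) + \<delta> ^ Suc T * w T) \<longlonglongrightarrow> (\<Sum>s. \<delta> ^ s * e s) + 0"
    by (rule tendsto_add)
  then show ?thesis
    using partial by (intro LIMSEQ_le_const2[where X = "\<lambda>T. (\<Sum>s<Suc T. \<delta> ^ s * e s) + \<delta> ^ Suc T * w T"]) auto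
qed

text \<open>The lower bound is the previous inequality applied to \<open>- e\<close> and
  \<open>- w\<close>.\<close>

lemma discounted_sum_eq:
  fixes e w :: "nat \<Rightarrow> real"
  assumes "0 < \<delta>" "\<delta> < 1" and e: "\<And>s. \<bar>e s\<bar> \<le> C" and w: "\<And>s. \<bar>w s\<bar> \<le> D"
    and step: "\<And>s. e (Suc s) + \<delta> * w (Suc s) = w s"
  shows "(\<Sum>s. \<delta> ^ s * e s) = e 0 + \<delta> * w 0"
proof (rule antisym)
  show "(\<Sum>s. \<delta> ^ s * e s) \<le> e 0 + \<delta> * w 0"
    using assms by (intro discounted_sum_le[OF _ _ e w]) auto
  have "(\<Sum>s. \<delta> ^ s * - e s) \<le> - e 0 + \<delta> * - w 0"
  proof (rule discounted_sum_le)
    show "\<bar>- e s\<bar> \<le> C" "\<bar>- w s\<bar> \<le> D" for s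
      using e w by simp_all
    show "- e (Suc s) + \<delta> * - w (Suc s) \<le> - w s" for s
      using step[of s] by simp
  qed fact+
  then show "e 0 + \<delta> * w 0 \<le> (\<Sum>s. \<delta> ^ s * e s)"
    using suminf_minus[OF summable_discounted[OF assms(1,2) e]] by simp
qed

section \<open>Reachable nodes and consistent beliefs\<close>

lemma after_removal_subset: "after_removal g d \<subseteq> g"
  by (auto simp: after_removal_def)

lemma after_removal_keep [simp]: "after_removal g (\<lambda>_. Keep) = g"
  by (simp add: after_removal_def)

lemma in_after_removal_iff:
  "{i, j} \<in> after_removal g d \<longleftrightarrow> {i, j} \<in> g \<and> d (i, j) = Keep \<and> d (j, i) = Keep"
proof -
  have "(\<exists>k l. {i, j} = {k, l} \<and> d (k, l) = Remove) \<longleftrightarrow> d (i, j) = Remove \<or> d (j, i) = Remove"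
    by (auto simp: doubleton_eq_iff)
  moreover have "d q = Keep \<longleftrightarrow> d q \<noteq> Remove" for q
    by (cases "d q") auto
  ultimately show ?thesis by (auto simp: after_removal_def)
qed

lemma net_subset: "net g h \<subseteq> g"
  by (induction g h rule: net.induct) (use after_removal_subset in fastforce)+

lemma is_network_subset: "is_network n g \<Longrightarrow> g' \<subseteq> g \<Longrightarrow> is_network n g'"
  by (auto simp: is_network_def)

lemma network_link_players:
  assumes "is_network n g" and "{i, j} \<in> g"
  shows "i \<in> players n" and "j \<in> players n" and "i \<noteq> j"
  using assms unfolding is_network_def complete_network_def by (auto simp: doubleton_eq_iff)

lemma finite_neighbors: "is_network n g \<Longrightarrow> finite (neighbors g i)"
  by (rule finite_subset[of _ "players n"]) (auto simp: neighbors_def players_def dest: network_link_players)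

lemma finite_link_pairs:
  assumes "is_network n g"
  shows "finite {(i, j). {i, j} \<in> net g h}"
proof (rule finite_subset)
  show "{(i, j). {i, j} \<in> net g h} \<subseteq> players n \<times> players n"
    using network_link_players[OF is_network_subset[OF assms net_subset]] by blast
qed (simp add: players_def)

lemma length_past_view [simp]: "length (past_view g i h) = length h"
  by (induction g i h rule: past_view.induct) auto

lemma length_private_hist [simp]: "length (fst (private_hist g i h)) = length h"
  by (simp add: private_hist_def)

lemma set_link_stage:
  assumes "is_network n g"
  shows "set_pmf (link_stage \<sigma> g h) = {d. \<forall>i j. if {i, j} \<in> net g h
    then d (i, j) \<in> set_pmf (link_dec (\<sigma> i) (private_hist g i h) j) else d (i, j) = Keep}"
  unfolding link_stage_def set_Pi_pmf[OF finite_link_pairs[OF assms]]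
  by (auto simp: PiE_dflt_def split: if_splits)

lemma finite_link_stage:
  assumes "is_network n g"
  shows "finite (set_pmf (link_stage \<sigma> g h))"
  unfolding link_stage_def set_Pi_pmf[OF finite_link_pairs[OF assms]]
  by (rule finite_PiE_dflt[OF finite_link_pairs[OF assms]]) simp

lemma finite_favor_stage: "finite (set_pmf (favor_stage \<sigma> g z))"
  by (auto simp: favor_stage_def split: prod.split option.split)

lemma favor_stage_cases:
  assumes "h' \<in> set_pmf (favor_stage \<sigma> g (h, d, \<omega>))"
  obtains a where "h' = (d, \<omega>, a) # h"
    and "a = None \<longleftrightarrow> meeting (after_removal (net g h) d) \<omega> = None"
    and "\<And>r s x. meeting (after_removal (net g h) d) \<omega> = Some (r, s) \<Longrightarrow> a = Some x \<Longrightarrow>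
      x \<in> set_pmf (favor_dec (\<sigma> s) (private_hist g s h) (own_links s d) r)"
  using assms by (auto simp: favor_stage_def split: option.splits prod.splits)

lemma meeting_SomeD:
  assumes "meeting g \<omega> = Some (i, j)"
  shows "{i, j} \<in> g" and "\<omega> = Some (i, j, True)"
  using assms by (auto simp: meeting_def split: option.splits prod.splits if_splits)

lemma meeting_links:
  assumes "meeting (after_removal (net g h) d) \<omega> = Some (i, j)"
  shows "{i, j} \<in> net g h"
  using meeting_SomeD(1)[OF assms] after_removal_subset by blast

context favor_exchange
begin

lemma finite_nature: "n \<ge> 1 \<Longrightarrow> finite (set_pmf nature)"
  unfolding nature_def by (auto simp: players_def)

lemma set_nature:
  assumes "n \<ge> 1" "0 < \<alpha>" "real n * \<alpha> \<le> 1" "0 < p" "p < 1"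
    and "i \<in> players n" "k \<in> players n"
  shows "Some (i, k, b) \<in> set_pmf nature"
proof -
  have "finite (players n)" "players n \<noteq> {}"
    using assms by (auto simp: players_def)
  moreover have "b \<in> set_pmf (bernoulli_pmf p)"
    using assms by (auto simp: set_pmf_bernoulli UNIV_bool)
  moreover have "True \<in> set_pmf (bernoulli_pmf (real n * \<alpha>))"
    using assms by (simp add: set_pmf_iff)
  ultimately show ?thesis
    unfolding nature_def using assms by (auto intro!: bexI[of _ True])
qed

lemma set_interim_stage:
  "set_pmf (interim_stage \<sigma> g h) = {h} \<times> set_pmf (link_stage \<sigma> g h) \<times> set_pmf nature"
  unfolding interim_stage_def by auto

lemma pmf_interim_stage:
  "pmf (interim_stage \<sigma> g h) (h, d, \<omega>) = pmf (link_stage \<sigma> g h) d * pmf nature \<omega>"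
proof -
  have "interim_stage \<sigma> g h = map_pmf (Pair h) (pair_pmf (link_stage \<sigma> g h) nature)"
    by (simp add: interim_stage_def pair_pmf_def map_bind_pmf)
  then show ?thesis
    by (simp add: pmf_map_inj' inj_def pmf_pair)
qed

lemma finite_interim_stage:
  "n \<ge> 1 \<Longrightarrow> is_network n g \<Longrightarrow> finite (set_pmf (interim_stage \<sigma> g h))"
  by (simp add: set_interim_stage finite_link_stage finite_nature)

lemma finite_play_period:
  "n \<ge> 1 \<Longrightarrow> is_network n g \<Longrightarrow> finite (set_pmf (play_period \<sigma> g h))"
  by (simp add: play_period_def finite_interim_stage finite_favor_stage)

lemma finite_run: "n \<ge> 1 \<Longrightarrow> is_network n g \<Longrightarrow> finite (set_pmf (run \<sigma> g t h))"
  by (induction t) (auto simp: finite_play_period)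

lemma finite_interim_run:
  "n \<ge> 1 \<Longrightarrow> is_network n g \<Longrightarrow> finite (set_pmf (interim_run \<sigma> g t))"
  by (simp add: interim_run_def finite_run finite_interim_stage)

lemma length_run: "h \<in> set_pmf (run \<sigma> g t h0) \<Longrightarrow> length h = t + length h0"
  by (induction t arbitrary: h)
    (auto simp: play_period_def set_interim_stage elim!: favor_stage_cases)

lemma length_interim_run: "(h, d, \<omega>) \<in> set_pmf (interim_run \<sigma> g t) \<Longrightarrow> length h = t"
  using length_run by (fastforce simp: interim_run_def set_interim_stage)

section \<open>Full support of completely mixed profiles\<close>

lemma completely_mixedD:
  assumes "completely_mixed \<tau>" and "i \<in> players n"
  shows "set_pmf (link_dec (\<tau> i) x j) = UNIV" and "set_pmf (favor_dec (\<tau> i) x y j) = UNIV"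
  using assms unfolding completely_mixed_def by blast+

lemma set_favor_stage_mixed:
  assumes "is_network n g" and "completely_mixed \<tau>"
  shows "set_pmf (favor_stage \<sigma> g z) \<subseteq> set_pmf (favor_stage \<tau> g z)"
proof (cases z)
  case (fields h d \<omega>)
  show ?thesis
  proof (cases "meeting (after_removal (net g h) d) \<omega>")
    case (Some q)
    obtain r s where q: "q = (r, s)" by (cases q)
    \<comment> \<open>Complete mixing constrains players only, so the provider has to be recognized
      as one.\<close>
    have "s \<in> players n"
      using network_link_players(2)[OF is_network_subset[OF assms(1) net_subset]] meeting_links Some q
      by blast
    then show ?thesis
      using Some q fields by (auto simp: favor_stage_def completely_mixedD[OF assms(2)])
  qed (simp add: fields favor_stage_def)
qed

lemma set_interim_stage_mixed:
  assumes "is_network n g" and "completely_mixed \<tau>"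
  shows "set_pmf (interim_stage \<sigma> g h) \<subseteq> set_pmf (interim_stage \<tau> g h)"
proof -
  have "i \<in> players n" if "{i, j} \<in> net g h" for i j
    using network_link_players(1)[OF is_network_subset[OF assms(1) net_subset]] that .
  then show ?thesis
    unfolding set_interim_stage set_link_stage[OF assms(1)]
    by (auto simp: completely_mixedD[OF assms(2)] split: if_splits)
qed

lemma set_run_mixed:
  assumes "is_network n g" and "completely_mixed \<tau>"
  shows "set_pmf (run \<sigma> g t h) \<subseteq> set_pmf (run \<tau> g t h)"
proof (induction t)
  case (Suc t)
  have "set_pmf (play_period \<sigma> g h) \<subseteq> set_pmf (play_period \<tau> g h)" for h
    using set_interim_stage_mixed[OF assms] set_favor_stage_mixed[OF assms]
    by (fastforce simp: play_period_def)
  with Suc show ?case by fastforce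
qed simp

text \<open>One completely mixed profile reaches whatever any profile can reach. The union over all
  profiles that defines the nodes of a period is therefore the support of a single distribution, and
  in particular finite.\<close>

lemma link_nodes_mixed:
  assumes "is_network n g" and "completely_mixed \<tau>"
  shows "link_nodes g t = set_pmf (run \<tau> g t [])"
  using set_run_mixed[OF assms] by (auto simp: link_nodes_def)

lemma interim_nodes_mixed:
  assumes "is_network n g" and "completely_mixed \<tau>"
  shows "interim_nodes g t = set_pmf (interim_run \<tau> g t)"
  using set_run_mixed[OF assms] set_interim_stage_mixed[OF assms]
  unfolding interim_nodes_def interim_run_def by fastforce

section \<open>Trembles and consistent beliefs\<close>

text \<open>Mixes in the uniform distribution with weight \<open>1 / (m + 2)\<close>; the shift by 2
  keeps this weight strictly between 0 and 1 already at \<open>m = 0\<close>.\<close>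

definition tremble :: "profile \<Rightarrow> nat \<Rightarrow> profile" where
  "tremble \<sigma> m i = \<lparr>
     link_dec = (\<lambda>x j. bernoulli_pmf (1 / real (m + 2)) \<bind>
       (\<lambda>b. if b then pmf_of_set UNIV else link_dec (\<sigma> i) x j)),
     favor_dec = (\<lambda>x y j. bernoulli_pmf (1 / real (m + 2)) \<bind>
       (\<lambda>b. if b then pmf_of_set UNIV else favor_dec (\<sigma> i) x y j)) \<rparr>"

lemma completely_mixed_tremble: "completely_mixed (tremble \<sigma> m)"
proof -
  have "set_pmf (bernoulli_pmf (1 / real (m + 2))) = UNIV"
    by (simp add: set_pmf_bernoulli)
  then show ?thesis
    by (simp add: completely_mixed_def tremble_def UNIV_bool del: of_nat_add)
qed

lemma tendsto_tremble:
  "(\<lambda>m. pmf (bernoulli_pmf (1 / real (m + 2)) \<bind> (\<lambda>b. if b then Q else P)) a) \<longlonglongrightarrow> pmf P a"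
proof -
  have "pmf (bernoulli_pmf (1 / real (m + 2)) \<bind> (\<lambda>b. if b then Q else P)) a =
      1 / real (m + 2) * pmf Q a + (1 - 1 / real (m + 2)) * pmf P a" for m
    by (simp add: pmf_bind)
  moreover have "(\<lambda>m. 1 / real (m + 2)) \<longlonglongrightarrow> 0"
    using LIMSEQ_ignore_initial_segment[OF lim_1_over_n, of 2] by simp
  then have "(\<lambda>m. 1 / real (m + 2) * pmf Q a + (1 - 1 / real (m + 2)) * pmf P a)
      \<longlonglongrightarrow> 0 * pmf Q a + (1 - 0) * pmf P a"
    by (intro tendsto_intros)
  ultimately show ?thesis by simp
qed

lemma profile_limit_tremble: "profile_limit (tremble \<sigma>) \<sigma>"
  unfolding profile_limit_def tremble_def
  by (simp only: strategy.select_convs tendsto_tremble) simp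

lemma profile_limit_subseq:
  assumes "profile_limit S \<sigma>" and "strict_mono r"
  shows "profile_limit (S \<circ> r) \<sigma>"
proof -
  have sub: "(\<lambda>m. f ((S \<circ> r) m)) \<longlonglongrightarrow> l" if "(\<lambda>m. f (S m)) \<longlonglongrightarrow> l" for f and l :: real
    using LIMSEQ_subseq_LIMSEQ[OF that assms(2)] by (simp add: o_def)
  show ?thesis
    unfolding profile_limit_def
  proof (intro ballI allI conjI, goal_cases)
    case (1 i x y j a)
    then show ?case
      using assms(1) sub[of "\<lambda>\<rho>. pmf (link_dec (\<rho> i) x j) a"] unfolding profile_limit_def by blast
  next
    case (2 i x y j a)
    then show ?case
      using assms(1) sub[of "\<lambda>\<rho>. pmf (favor_dec (\<rho> i) x y j) a"] unfolding profile_limit_def by blast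
  qed
qed

text \<open>Beliefs are obtained as a limit of Bayesian beliefs along a subsequence of trembles. The
  support statements are what optimality of grim play requires of them: finiteness, so that
  expectations can be compared pointwise, and at the favor stage concentration on nodes where the
  given request is really made.\<close>

lemma consistent_beliefs_exist:
  assumes "n \<ge> 1" and net: "is_network n g"
  obtains \<mu> where "consistent g \<sigma> \<mu>"
    and "\<And>t h i. h \<in> link_nodes g t \<Longrightarrow> i \<in> players n \<Longrightarrow>
      finite (set_pmf (link_belief \<mu> i (private_hist g i h)))"
    and "\<And>t h d \<omega> i j. (h, d, \<omega>) \<in> interim_nodes g t \<Longrightarrow>
      meeting (after_removal (net g h) d) \<omega> = Some (j, i) \<Longrightarrow>
      finite (set_pmf (favor_belief \<mu> i (private_hist g i h) (own_links i d) j)) \<and>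
      set_pmf (favor_belief \<mu> i (private_hist g i h) (own_links i d) j) \<subseteq>
        favor_info_set g i (private_hist g i h) (own_links i d) j"
proof -
  let ?S = "tremble \<sigma>"
  \<comment> \<open>\<open>LK\<close> and \<open>FK\<close> collect the information sets that occur
    at the two stages, \<open>LA\<close> and \<open>FA\<close> the finitely many nodes that beliefs
    there can charge, and \<open>LB\<close> and \<open>FB\<close> the Bayesian beliefs along the
    trembles.\<close>
  define LK where "LK = (\<Union>t. \<Union>h\<in>link_nodes g t. \<Union>i\<in>players n. {(i, private_hist g i h)})"
  define FK where "FK = (\<Union>t. \<Union>(h, d, \<omega>)\<in>interim_nodes g t.
    {(i, private_hist g i h, own_links i d, j) |i j.
      meeting (after_removal (net g h) d) \<omega> = Some (j, i)})"
  define LA where "LA = (\<lambda>(i, x). link_nodes g (length (fst x)) \<inter> link_info_set g i x)"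
  define FA where "FA = (\<lambda>(i, x, y, j). interim_nodes g (length (fst x)) \<inter> favor_info_set g i x y j)"
  define LB where "LB = (\<lambda>m (i, x). link_belief (bayes_beliefs g (?S m)) i x)"
  define FB where "FB = (\<lambda>m (i, x, y, j). favor_belief (bayes_beliefs g (?S m)) i x y j)"
  note mixed = completely_mixed_tremble
  have fin_ln: "finite (link_nodes g t)" for t
    using finite_run[OF assms] by (simp add: link_nodes_mixed[OF net mixed[of \<sigma> 0]])
  have fin_in: "finite (interim_nodes g t)" for t
    using finite_interim_run[OF assms] by (simp add: interim_nodes_mixed[OF net mixed[of \<sigma> 0]])
  have count_LK: "countable LK"
  proof -
    have "finite (\<Union>h\<in>link_nodes g t. \<Union>i\<in>players n. {(i, private_hist g i h)})" for t
      using fin_ln by (simp add: players_def)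
    then show ?thesis
      unfolding LK_def by (rule countable_UN[OF countableI_type countable_finite])
  qed
  have meet_fin: "finite {(i, x i, y i, j) |i j. meeting G \<omega> = Some (j, i)}" for x :: "nat \<Rightarrow> private_history"
      and y :: "nat \<Rightarrow> nat \<Rightarrow> link_act" and G \<omega>
    by (cases "meeting G \<omega>") auto
  have count_FK: "countable FK"
  proof -
    have "finite (\<Union>(h, d, \<omega>)\<in>interim_nodes g t. {(i, private_hist g i h, own_links i d, j) |i j.
        meeting (after_removal (net g h) d) \<omega> = Some (j, i)})" for t
      using fin_in by (intro finite_UN_I) (auto intro: meet_fin)
    then show ?thesis
      unfolding FK_def by (rule countable_UN[OF countableI_type countable_finite])
  qed
  have len_link: "length h = t" if "h \<in> link_nodes g t" for h t
    using that by (auto simp: link_nodes_def dest: length_run)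
  have len_interim: "length h = t" if "(h, d, \<omega>) \<in> interim_nodes g t" for h d \<omega> t
    using that by (auto simp: interim_nodes_def dest: length_interim_run)
  have LK_cond: "set_pmf (LB m k) \<subseteq> LA k"
    if k_in: "k \<in> LK" for m k
  proof -
    obtain t h i where h: "h \<in> link_nodes g t" and k: "k = (i, private_hist g i h)"
      using k_in unfolding LK_def by blast
    \<comment> \<open>The tremble reaches \<open>h\<close> itself with positive probability, so the
      conditioning event is not null and \<open>cond_pmf\<close> has its usual meaning.\<close>
    then have ne: "h \<in> set_pmf (run (?S m) g (length h) []) \<inter> link_info_set g i (private_hist g i h)"
      using len_link[OF h] by (simp add: link_nodes_mixed[OF net mixed[of \<sigma> m]] link_info_set_def)
    show ?thesis
      using set_cond_pmf[OF ex_in_conv[THEN iffD1, OF exI, OF ne]]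
      unfolding k LA_def LB_def link_nodes_mixed[OF net mixed[of \<sigma> m]]
      by (simp add: bayes_beliefs_def)
  qed
  have FK_cond: "set_pmf (FB m k) \<subseteq> FA k"
    if k_in: "k \<in> FK" for m k
  proof -
    obtain t h d \<omega> i j where h: "(h, d, \<omega>) \<in> interim_nodes g t"
      and k: "k = (i, private_hist g i h, own_links i d, j)"
      and meet: "meeting (after_removal (net g h) d) \<omega> = Some (j, i)"
      using k_in unfolding FK_def by blast
    then have ne: "(h, d, \<omega>) \<in> set_pmf (interim_run (?S m) g (length h)) \<inter>
        favor_info_set g i (private_hist g i h) (own_links i d) j"
      using len_interim[OF h] by (simp add: interim_nodes_mixed[OF net mixed[of \<sigma> m]] favor_info_set_def)
    show ?thesis
      using set_cond_pmf[OF ex_in_conv[THEN iffD1, OF exI, OF ne]]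
      unfolding k FA_def FB_def interim_nodes_mixed[OF net mixed[of \<sigma> m]]
      by (simp add: bayes_beliefs_def)
  qed
  have fin_LA: "finite (LA k)" and fin_FA: "finite (FA k')" for k k'
    using fin_ln fin_in by (auto simp: LA_def FA_def split: prod.split)
  obtain r1 Q1 where r1: "strict_mono r1"
    and Q1: "\<And>k. k \<in> LK \<Longrightarrow> set_pmf (Q1 k) \<subseteq> LA k"
    and lim1: "\<And>k z. k \<in> LK \<Longrightarrow>
      (\<lambda>m. pmf (LB (r1 m) k) z) \<longlonglongrightarrow> pmf (Q1 k) z"
    using pmf_family_convergent_subsequence[where P = LB, OF count_LK fin_LA LK_cond] by blast
  \<comment> \<open>The second extraction runs inside the first, so both kinds of beliefs converge
    along \<open>r1 \<circ> r2\<close>.\<close>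
  obtain r2 Q2 where r2: "strict_mono r2"
    and Q2: "\<And>k. k \<in> FK \<Longrightarrow> set_pmf (Q2 k) \<subseteq> FA k"
    and lim2: "\<And>k z. k \<in> FK \<Longrightarrow>
      (\<lambda>m. pmf (FB (r1 (r2 m)) k) z)
        \<longlonglongrightarrow> pmf (Q2 k) z"
    using pmf_family_convergent_subsequence[where P = "\<lambda>m. FB (r1 m)", OF count_FK fin_FA FK_cond] by blast
  define \<mu> where "\<mu> = \<lparr>link_belief = (\<lambda>i x. Q1 (i, x)), favor_belief = (\<lambda>i x y j. Q2 (i, x, y, j))\<rparr>"
  have LK_I: "(i, private_hist g i h) \<in> LK" if "h \<in> link_nodes g t" "i \<in> players n" for i h t
    using that by (auto simp: LK_def)
  have FK_I: "(i, private_hist g i h, own_links i d, j) \<in> FK"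
    if "(h, d, \<omega>) \<in> interim_nodes g t" "meeting (after_removal (net g h) d) \<omega> = Some (j, i)" for i j h d \<omega> t
    using that by (fastforce simp: FK_def)
  have "beliefs_limit g (\<lambda>m. bayes_beliefs g ((?S \<circ> (r1 \<circ> r2)) m)) \<mu>"
    unfolding beliefs_limit_def Let_def
  proof (intro conjI allI ballI impI, goal_cases)
    case (1 t h i z)
    from LIMSEQ_subseq_LIMSEQ[OF lim1[OF LK_I[OF 1]] r2, of z]
    show ?case by (simp add: \<mu>_def LB_def o_def)
  next
    case (2 t q)
    show ?case
    proof (cases q)
      case (fields h d \<omega>)
      with 2 have "(h, d, \<omega>) \<in> interim_nodes g t" by simp
      from lim2[OF FK_I[OF this]] fields show ?thesis by (simp add: \<mu>_def FB_def o_def)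
    qed
  qed
  moreover have "profile_limit (?S \<circ> (r1 \<circ> r2)) \<sigma>"
    by (intro profile_limit_subseq profile_limit_tremble strict_mono_o r1 r2)
  ultimately have "consistent g \<sigma> \<mu>"
    unfolding consistent_def using mixed by (intro exI[of _ "?S \<circ> (r1 \<circ> r2)"]) simp
  then show thesis
  proof (rule that)
    fix t h i assume "h \<in> link_nodes g t" "i \<in> players n"
    from Q1[OF LK_I[OF this]] show "finite (set_pmf (link_belief \<mu> i (private_hist g i h)))"
      by (auto simp: \<mu>_def intro: finite_subset fin_LA)
  next
    fix t h d \<omega> i j
    assume "(h, d, \<omega>) \<in> interim_nodes g t" "meeting (after_removal (net g h) d) \<omega> = Some (j, i)"
    from Q2[OF FK_I[OF this]]
    show "finite (set_pmf (favor_belief \<mu> i (private_hist g i h) (own_links i d) j)) \<and>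
      set_pmf (favor_belief \<mu> i (private_hist g i h) (own_links i d) j) \<subseteq>
        favor_info_set g i (private_hist g i h) (own_links i d) j"
      by (auto simp: \<mu>_def FA_def intro: finite_subset[OF _ fin_in])
  qed
qed

end

section \<open>Bilateral histories and grim play\<close>

text \<open>A bilateral entry read off the full period directly. The intermediate filter
  \<open>observed\<close> disappears because every meeting of the pair is seen by both of its
  members.\<close>

definition pair_entry :: "nat \<Rightarrow> nat \<Rightarrow> (nat \<times> nat) option \<Rightarrow> favor_act option \<Rightarrow>
    (nat \<times> nat \<times> favor_act) option" where
  "pair_entry i j m a = (case (m, a) of
       (Some (r, s), Some x) \<Rightarrow> if {r, s} = {i, j} then Some (r, s, x) else None
     | _ \<Rightarrow> None)"

lemma bilateral_hist_Nil [simp]: "bilateral_hist i j (private_hist g i []) = []"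
  by (simp add: bilateral_hist_def private_hist_def)

lemma bilateral_hist_Cons [simp]:
  "bilateral_hist i j (private_hist g i ((d, \<omega>, a) # h)) =
    pair_entry i j (meeting (after_removal (net g h) d) \<omega>) a # bilateral_hist i j (private_hist g i h)"
  by (auto simp: bilateral_hist_def private_hist_def pair_entry_def observed_def doubleton_eq_iff
      split: option.splits)

text \<open>Entries name requester and provider rather than self and other, so both ends hold the
  same record. Punishments based on it are thus automatically coordinated.\<close>

lemma bilateral_hist_commute:
  "bilateral_hist i j (private_hist g i h) = bilateral_hist j i (private_hist g j h)"
  by (induction h) (auto simp: pair_entry_def insert_commute split: option.splits prod.splits)

text \<open>Bilateral histories contain no link decisions, so defections are the only breach that a
  measurable strategy can react to; either end's defection counts.\<close>

definition clean :: "(nat \<times> nat \<times> favor_act) option list \<Rightarrow> bool" where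
  "clean L \<longleftrightarrow> (\<forall>r s. Some (r, s, Defect) \<notin> set L)"

lemma clean_Nil [simp]: "clean []"
  by (simp add: clean_def)

lemma clean_pair_entry:
  "clean (pair_entry i j m a # L) \<longleftrightarrow>
    clean L \<and> \<not> (a = Some Defect \<and> (m = Some (i, j) \<or> m = Some (j, i)))"
  by (auto simp: clean_def pair_entry_def doubleton_eq_iff split: option.splits)

abbreviation clean_pair :: "network \<Rightarrow> nat \<Rightarrow> nat \<Rightarrow> history \<Rightarrow> bool" where
  "clean_pair g i j h \<equiv> clean (bilateral_hist i j (private_hist g i h))"

lemma clean_pair_commute: "clean_pair g i j h \<longleftrightarrow> clean_pair g j i h"
  by (simp add: bilateral_hist_commute)

lemma clean_pair_Cons:
  "clean_pair g i j ((d, \<omega>, a) # h) \<longleftrightarrow> clean_pair g i j h \<and>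
    \<not> (a = Some Defect \<and> (meeting (after_removal (net g h) d) \<omega> = Some (i, j) \<or>
       meeting (after_removal (net g h) d) \<omega> = Some (j, i)))"
  by (simp add: clean_pair_entry)

section \<open>Standing assumptions and one-period verification of values\<close>

locale favor_exchange_game = favor_exchange n \<alpha> p \<delta> v c \<gamma>
  for n :: nat and \<alpha> p \<delta> v c \<gamma> :: real +
  fixes g :: network
  assumes n: "n \<ge> 1" and \<alpha>: "0 < \<alpha>" and n\<alpha>: "real n * \<alpha> \<le> 1" and p: "0 < p" "p < 1"
    and \<delta>: "0 < \<delta>" "\<delta> < 1" and c: "0 < c" "c < v" and \<gamma>: "0 \<le> \<gamma>" "\<gamma> < c"
    and network: "is_network n g"
begin

text \<open>The constant \<open>V\<close>: the present value of \<open>phat * (v - c)\<close> in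
  every period, the current one included. This accounts for the recursion
  \<open>link_value_eq\<close>.\<close>

definition link_value :: real where
  "link_value = phat * (v - c) / (1 - \<delta>)"

lemma link_value_pos: "0 < link_value"
  using n \<alpha> p \<delta> c by (simp add: link_value_def phat_def)

lemma link_value_eq: "phat * (v - c) + \<delta> * link_value = link_value"
  using \<delta> by (simp add: link_value_def field_simps)

lemma network_net: "is_network n (net g h)"
  using is_network_subset[OF network net_subset] .

lemma network_removal: "is_network n (after_removal (net g h) d)"
  using is_network_subset[OF network_net after_removal_subset] .

lemma meeting_distinct: "meeting (after_removal (net g h) d) \<omega> = Some (r, s) \<Longrightarrow> r \<noteq> s"
  using network_link_players(3)[OF network_removal] meeting_SomeD(1) by blast

lemma abs_last_payoff_le: "\<bar>last_payoff g i h\<bar> \<le> v"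
proof (cases h)
  case (Cons q h')
  obtain d \<omega> a where "q = (d, \<omega>, a)" by (cases q)
  with Cons c \<gamma> show ?thesis
    by (auto simp: payoff_def split: option.split favor_act.split)
qed (use c in simp)

lemma link_stageD:
  assumes "d \<in> set_pmf (link_stage \<sigma> g h)" and "{i, j} \<in> net g h"
  shows "d (i, j) \<in> set_pmf (link_dec (\<sigma> i) (private_hist g i h) j)"
  using assms unfolding set_link_stage[OF network] by auto

lemma run_0: "run \<sigma> g 0 = return_pmf"
  by (rule ext) simp

lemma run_Suc: "run \<sigma> g (Suc s) = (\<lambda>h. bind_pmf (run \<sigma> g s h) (play_period \<sigma> g))"
  by (rule ext) simp

lemma expectation_play_period:
  "measure_pmf.expectation (play_period \<sigma> g h) F =
    measure_pmf.expectation (link_stage \<sigma> g h) (\<lambda>d. measure_pmf.expectation nature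
      (\<lambda>\<omega>. measure_pmf.expectation (favor_stage \<sigma> g (h, d, \<omega>)) F))"
  for F :: "history \<Rightarrow> real"
  unfolding play_period_def interim_stage_def
  by (simp add: expectation_bind_finite finite_link_stage[OF network] finite_nature[OF n]
      finite_favor_stage bind_assoc_pmf bind_return_pmf)

lemma run_invariant:
  assumes run: "h' \<in> set_pmf (run \<sigma> g s h)" and "I h"
    and "\<And>h h'. I h \<Longrightarrow> h' \<in> set_pmf (play_period \<sigma> g h) \<Longrightarrow> I h'"
  shows "I h'"
  using assms(1) by (induction s arbitrary: h') (use assms(2,3) in auto)

text \<open>Conditioning on the history before the last period turns the step condition for
  sequences of expected payoffs into a condition on a single period of play.\<close>

lemma expectation_run_Suc:
  assumes "finite (set_pmf Q)"
  shows "measure_pmf.expectation (bind_pmf Q (run \<sigma> g (Suc s))) (last_payoff g i) +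
      \<delta> * measure_pmf.expectation (bind_pmf Q (run \<sigma> g (Suc s))) W =
    measure_pmf.expectation (bind_pmf Q (run \<sigma> g s)) (\<lambda>h.
      measure_pmf.expectation (play_period \<sigma> g h) (\<lambda>h'. last_payoff g i h' + \<delta> * W h'))"
proof -
  have fin: "finite (set_pmf (bind_pmf Q (run \<sigma> g s)))" for s
    using assms finite_run[OF n network] by simp
  have "measure_pmf.expectation (bind_pmf Q (run \<sigma> g (Suc s))) (last_payoff g i) +
      \<delta> * measure_pmf.expectation (bind_pmf Q (run \<sigma> g (Suc s))) W =
    measure_pmf.expectation (bind_pmf Q (run \<sigma> g (Suc s))) (\<lambda>h. last_payoff g i h + \<delta> * W h)"
    by (subst Bochner_Integration.integral_add) (auto intro!: integrable_measure_pmf_finite fin simp del: run.simps)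
  also have "\<dots> = measure_pmf.expectation (bind_pmf (bind_pmf Q (run \<sigma> g s)) (play_period \<sigma> g))
      (\<lambda>h. last_payoff g i h + \<delta> * W h)"
    by (simp only: run_Suc bind_assoc_pmf)
  also have "\<dots> = measure_pmf.expectation (bind_pmf Q (run \<sigma> g s)) (\<lambda>h.
      measure_pmf.expectation (play_period \<sigma> g h) (\<lambda>h'. last_payoff g i h' + \<delta> * W h'))"
    by (rule expectation_bind_finite[OF fin finite_play_period[OF n network]])
  finally show ?thesis .
qed

text \<open>\<open>W\<close> values a history at the start of the next period. If no single period
  improves on it in expectation, \<open>discounted_sum_le\<close> applies to the expected payoffs
  and the expected values of \<open>W\<close>.\<close>

lemma discounted_payoff_le:
  assumes fin: "finite (set_pmf Q)" and bdd: "\<And>h. \<bar>W h\<bar> \<le> D"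
    and le: "\<And>h. measure_pmf.expectation (play_period \<sigma> g h)
      (\<lambda>h'. last_payoff g i h' + \<delta> * W h') \<le> W h"
  shows "discounted_payoff \<sigma> g i Q \<le> measure_pmf.expectation Q (\<lambda>h. last_payoff g i h + \<delta> * W h)"
proof -
  let ?R = "\<lambda>s. bind_pmf Q (run \<sigma> g s)"
  have fin_R: "finite (set_pmf (?R s))" for s
    using fin finite_run[OF n network] by simp
  have "discounted_payoff \<sigma> g i Q \<le> measure_pmf.expectation (?R 0) (last_payoff g i) +
      \<delta> * measure_pmf.expectation (?R 0) W"
    unfolding discounted_payoff_def
  proof (rule discounted_sum_le[OF \<delta>])
    show "\<bar>measure_pmf.expectation (?R s) (last_payoff g i)\<bar> \<le> v"
      "\<bar>measure_pmf.expectation (?R s) W\<bar> \<le> D" for s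
      using abs_expectation_le[OF fin_R] abs_last_payoff_le bdd by blast+
  qed (unfold expectation_run_Suc[OF fin], rule expectation_mono_finite[OF fin_R le])
  then show ?thesis
    using fin by (simp add: run_0 bind_return_pmf' integrable_measure_pmf_finite)
qed

text \<open>The invariant \<open>I\<close> is carried along because the value of cooperating on
  selected links is exact only while these links are present and free of defections.\<close>

lemma discounted_payoff_eq:
  assumes fin: "finite (set_pmf Q)" and bdd: "\<And>h. \<bar>W h\<bar> \<le> D"
    and start: "\<And>h. h \<in> set_pmf Q \<Longrightarrow> I h"
    and step: "\<And>h h'. I h \<Longrightarrow> h' \<in> set_pmf (play_period \<sigma> g h) \<Longrightarrow> I h'"
    and eq: "\<And>h. I h \<Longrightarrow> measure_pmf.expectation (play_period \<sigma> g h)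
      (\<lambda>h'. last_payoff g i h' + \<delta> * W h') = W h"
  shows "discounted_payoff \<sigma> g i Q = measure_pmf.expectation Q (\<lambda>h. last_payoff g i h + \<delta> * W h)"
proof -
  let ?R = "\<lambda>s. bind_pmf Q (run \<sigma> g s)"
  have fin_R: "finite (set_pmf (?R s))" for s
    using fin finite_run[OF n network] by simp
  have "discounted_payoff \<sigma> g i Q = measure_pmf.expectation (?R 0) (last_payoff g i) +
      \<delta> * measure_pmf.expectation (?R 0) W"
    unfolding discounted_payoff_def
  proof (rule discounted_sum_eq[OF \<delta>])
    show "\<bar>measure_pmf.expectation (?R s) (last_payoff g i)\<bar> \<le> v"
      "\<bar>measure_pmf.expectation (?R s) W\<bar> \<le> D" for s
      using abs_expectation_le[OF fin_R] abs_last_payoff_le bdd by blast+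
    have "I h" if h_in: "h \<in> set_pmf (?R s)" for h s
    proof -
      obtain h0 where h0: "h0 \<in> set_pmf Q" and h: "h \<in> set_pmf (run \<sigma> g s h0)"
        using h_in by auto
      then show ?thesis
        by (intro run_invariant[where I = I, OF h]) (auto intro: start[OF h0] step)
    qed
    then show "measure_pmf.expectation (?R (Suc s)) (last_payoff g i) +
        \<delta> * measure_pmf.expectation (?R (Suc s)) W = measure_pmf.expectation (?R s) W" for s
      unfolding expectation_run_Suc[OF fin] by (intro expectation_cong_pmf eq)
  qed
  then show ?thesis
    using fin by (simp add: run_0 bind_return_pmf' integrable_measure_pmf_finite)
qed

section \<open>Grim play and its value\<close>

definition clean_neighbors :: "nat \<Rightarrow> history \<Rightarrow> nat set" where
  "clean_neighbors i h = {k. {i, k} \<in> net g h \<and> clean_pair g i k h}"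

lemma clean_neighbors_subset: "clean_neighbors i h \<subseteq> neighbors g i"
  using net_subset by (auto simp: clean_neighbors_def neighbors_def)

lemma finite_clean_neighbors [simp]: "finite (clean_neighbors i h)"
  using finite_subset[OF clean_neighbors_subset finite_neighbors[OF network]] .

definition grim :: profile where
  "grim i = \<lparr>
     link_dec = (\<lambda>x j. return_pmf (if clean (bilateral_hist i j x) then Keep else Remove)),
     favor_dec = (\<lambda>x y j. return_pmf (if clean (bilateral_hist i j x) then Coop else Defect)) \<rparr>"

lemma grim_measurable: "bilaterally_measurable grim"
  by (simp add: bilaterally_measurable_def grim_def)

lemma clean_if_no_defection:
  assumes "\<And>d \<omega> a. (d, \<omega>, a) \<in> set h \<Longrightarrow> a \<noteq> Some Defect"
  shows "clean_pair g i j h"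
  using assms
proof (induction h)
  case (Cons q h)
  then show ?case by (cases q) (auto simp: clean_pair_entry)
qed simp

text \<open>As long as nobody has defected all bilateral histories are clean, and then grim play
  keeps every link and provides every favor.\<close>

lemma grim_cooperative: "cooperative_path g grim"
proof -
  have "\<forall>(d, \<omega>, a)\<in>set h. (\<forall>i j. d (i, j) = Keep) \<and> a \<noteq> Some Defect"
    if "h \<in> set_pmf (run grim g t [])" for t h
    using that
  proof (induction t arbitrary: h)
    case (Suc t)
    then obtain h0 d \<omega> where h0: "h0 \<in> set_pmf (run grim g t [])" and d: "d \<in> set_pmf (link_stage grim g h0)"
      and h: "h \<in> set_pmf (favor_stage grim g (h0, d, \<omega>))"
      by (auto simp: play_period_def set_interim_stage)
    have IH: "\<forall>(d, \<omega>, a)\<in>set h0. (\<forall>i j. d (i, j) = Keep) \<and> a \<noteq> Some Defect"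
      using Suc.IH h0 by blast
    have clean: "clean_pair g i j h0" for i j
      using IH by (intro clean_if_no_defection) auto
    have "d (i, j) = Keep" for i j
      using d unfolding set_link_stage[OF network] by (auto simp: grim_def clean split: if_splits)
    moreover from h obtain a where "h = (d, \<omega>, a) # h0" "a \<noteq> Some Defect"
      by (rule favor_stage_cases) (auto simp: grim_def clean split: if_splits option.splits)
    ultimately show ?case using IH by simp
  qed simp
  then show ?thesis unfolding cooperative_path_def by blast
qed

definition grim_value :: "nat \<Rightarrow> history \<Rightarrow> real" where
  "grim_value i h = link_value * real (card (clean_neighbors i h))"

text \<open>Seen from the period just completed: its payoff counts in full, and the value from the
  next period on is discounted once.\<close>

abbreviation total_value :: "nat \<Rightarrow> history \<Rightarrow> real" where
  "total_value i h \<equiv> last_payoff g i h + \<delta> * grim_value i h"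

lemma abs_grim_value_le: "\<bar>grim_value i h\<bar> \<le> link_value * real (degree g i)"
  using link_value_pos card_mono[OF finite_neighbors[OF network] clean_neighbors_subset]
  by (simp add: grim_value_def degree_def abs_mult)

lemma clean_neighbors_Cons:
  "clean_neighbors i ((d, \<omega>, a) # h) = {k. {i, k} \<in> after_removal (net g h) d \<and> clean_pair g i k h \<and>
    \<not> (a = Some Defect \<and> (meeting (after_removal (net g h) d) \<omega> = Some (i, k) \<or>
       meeting (after_removal (net g h) d) \<omega> = Some (k, i)))}"
  by (simp add: clean_neighbors_def clean_pair_entry)

text \<open>On a clean link, defecting saves \<open>c - \<gamma>\<close> and forfeits
  \<open>\<delta> * link_value\<close>. A link with a past defection carries no value any more, so
  only \<open>\<gamma> < c\<close> matters and defecting is best. The comparison holds at each node,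
  so no belief enters.\<close>

lemma grim_favor_optimal:
  assumes "c - \<gamma> \<le> \<delta> * link_value"
    and meet: "meeting (after_removal (net g h) d) \<omega> = Some (j, i)"
  shows "measure_pmf.expectation (favor_stage (grim(i := \<tau>)) g (h, d, \<omega>)) (total_value i) \<le>
    measure_pmf.expectation (favor_stage grim g (h, d, \<omega>)) (total_value i)"
proof -
  \<comment> \<open>The links that will still have value next period if \<open>i\<close> cooperates
    now; a defection takes \<open>j\<close> out of this set.\<close>
  define M where "M = {k. {i, k} \<in> after_removal (net g h) d \<and> clean_pair g i k h}"
  have ij: "i \<noteq> j" using meeting_distinct[OF meet] by simp
  have "M \<subseteq> neighbors g i"
    using after_removal_subset net_subset by (fastforce simp: M_def neighbors_def)
  then have fin: "finite M" using finite_neighbors[OF network] finite_subset by blast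
  have coop: "total_value i ((d, \<omega>, Some Coop) # h) = - c + \<delta> * (link_value * real (card M))"
    using meet ij by (simp add: payoff_def grim_value_def clean_neighbors_Cons M_def)
  have "clean_neighbors i ((d, \<omega>, Some Defect) # h) = M - {j}"
    using meet ij by (auto simp: clean_neighbors_Cons M_def)
  then have defect: "total_value i ((d, \<omega>, Some Defect) # h) =
      - \<gamma> + \<delta> * (link_value * real (card (M - {j})))"
    using meet ij by (simp add: payoff_def grim_value_def)
  define b where "b = (if clean_pair g i j h then Coop else Defect)"
  have best: "total_value i ((d, \<omega>, Some a) # h) \<le> total_value i ((d, \<omega>, Some b) # h)" for a
  proof (cases "clean_pair g i j h")
    case True
    then have "j \<in> M"
      using meeting_SomeD(1)[OF meet] by (simp add: M_def insert_commute)
    then have "real (card M) = real (card (M - {j})) + 1"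
      using fin card_Suc_Diff1[of M j] by simp
    then have "total_value i ((d, \<omega>, Some Defect) # h) \<le> total_value i ((d, \<omega>, Some Coop) # h)"
      unfolding coop defect using assms(1) by (simp add: algebra_simps)
    then show ?thesis using True by (cases a) (auto simp: b_def)
  next
    case False
    then have "M - {j} = M" by (auto simp: M_def)
    then have "total_value i ((d, \<omega>, Some Coop) # h) \<le> total_value i ((d, \<omega>, Some Defect) # h)"
      unfolding coop defect using \<gamma> by simp
    then show ?thesis using False by (cases a) (auto simp: b_def)
  qed
  have "measure_pmf.expectation (favor_stage (grim(i := \<tau>)) g (h, d, \<omega>)) (total_value i) \<le>
      total_value i ((d, \<omega>, Some b) # h)"
    using meet best
    by (intro expectation_le_const finite_favor_stage) (auto simp: favor_stage_def simp del: last_payoff.simps)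
  also have "\<dots> = measure_pmf.expectation (favor_stage grim g (h, d, \<omega>)) (total_value i)"
    using meet by (simp add: favor_stage_def grim_def b_def)
  finally show ?thesis .
qed

lemma favor_stage_deviation:
  assumes "\<And>r. meeting (after_removal (net g h) d) \<omega> \<noteq> Some (r, i)"
  shows "favor_stage (\<sigma>(i := \<tau>)) g (h, d, \<omega>) = favor_stage \<sigma> g (h, d, \<omega>)"
  using assms by (auto simp: favor_stage_def split: option.split)

text \<open>If all remaining links of \<open>i\<close> are clean, each meeting that involves her
  ends in \<open>Coop\<close> and spoils nothing. Other pairs may defect on each other, but this
  changes neither her payoff nor her clean links.\<close>

lemma expectation_favor_stage_grim:
  assumes clean: "\<And>k. {i, k} \<in> after_removal (net g h) d \<Longrightarrow> clean_pair g i k h"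
  shows "measure_pmf.expectation (favor_stage grim g (h, d, \<omega>)) (total_value i) =
      payoff i (meeting (after_removal (net g h) d) \<omega>) (Some Coop) +
      \<delta> * (link_value * real (degree (after_removal (net g h) d) i))"
proof -
  let ?G = "after_removal (net g h) d"
  have unaffected: "clean_neighbors i ((d, \<omega>, a) # h) = neighbors ?G i"
    if "a = Some Defect \<Longrightarrow> \<forall>k. meeting ?G \<omega> \<noteq> Some (i, k) \<and> meeting ?G \<omega> \<noteq> Some (k, i)" for a
    using that clean by (auto simp: clean_neighbors_Cons neighbors_def)
  show ?thesis
  proof (cases "meeting ?G \<omega>")
    case None
    then show ?thesis
      by (simp add: favor_stage_def payoff_def grim_value_def unaffected degree_def)
  next
    case (Some q)
    obtain r s where q: "q = (r, s)" by (cases q)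
    define a where "a = (if clean_pair g s r h then Coop else Defect)"
    have link: "{r, s} \<in> ?G" using meeting_SomeD(1) Some q by blast
    have a: "a = Coop" if "i = r \<or> i = s"
    proof -
      have "clean_pair g s r h"
        using that clean[of r] clean[of s] link clean_pair_commute[where i = r and j = s]
        by (auto simp: insert_commute)
      then show ?thesis by (simp add: a_def)
    qed
    have "clean_neighbors i ((d, \<omega>, Some a) # h) = neighbors ?G i"
      by (rule unaffected) (use Some q a in auto)
    moreover have "payoff i (meeting ?G \<omega>) (Some a) = payoff i (meeting ?G \<omega>) (Some Coop)"
      using a by (cases "i = r \<or> i = s") (auto simp: Some q payoff_def split: favor_act.split)
    ultimately have "total_value i ((d, \<omega>, Some a) # h) =
        payoff i (meeting ?G \<omega>) (Some Coop) + \<delta> * (link_value * real (degree ?G i))"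
      by (simp add: grim_value_def degree_def)
    then show ?thesis
      using Some q by (simp add: favor_stage_def grim_def a_def)
  qed
qed

text \<open>The recursion \<open>link_value_eq\<close>, multiplied by the number of links that
  remain.\<close>

lemma expected_period_value:
  assumes "i \<in> players n"
  shows "measure_pmf.expectation nature (\<lambda>\<omega>. payoff i (meeting (after_removal (net g h) d) \<omega>) (Some Coop) +
      \<delta> * (link_value * real (degree (after_removal (net g h) d) i))) =
    link_value * real (degree (after_removal (net g h) d) i)"
proof -
  let ?G = "after_removal (net g h) d"
  have "measure_pmf.expectation nature (\<lambda>\<omega>. payoff i (meeting ?G \<omega>) (Some Coop)) = period_payoff i ?G"
    using n \<alpha> n\<alpha> p network_removal assms by (intro expected_payoff_all_favors_provided) auto
  moreover have "period_payoff i ?G + \<delta> * (link_value * real (degree ?G i)) =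
      (phat * (v - c) + \<delta> * link_value) * real (degree ?G i)"
    by (simp add: period_payoff_def algebra_simps)
  ultimately show ?thesis
    unfolding link_value_eq by (simp add: integrable_measure_pmf_finite[OF finite_nature[OF n]])
qed

text \<open>The other end of a link follows grim play and removes it after a defection. A deviator
  can thus give up clean links but cannot rescue spoiled ones.\<close>

lemma neighbors_after_removal_grim:
  assumes "d \<in> set_pmf (link_stage (grim(i := \<tau>)) g h)"
  shows "neighbors (after_removal (net g h) d) i \<subseteq> clean_neighbors i h"
proof
  fix k assume "k \<in> neighbors (after_removal (net g h) d) i"
  then have link: "{i, k} \<in> net g h" and keep: "d (k, i) = Keep"
    by (auto simp: neighbors_def in_after_removal_iff)
  then have "{k, i} \<in> net g h" and "k \<noteq> i"
    using network_link_players(3)[OF network_net] by (auto simp: insert_commute)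
  then have "clean_pair g k i h"
    using link_stageD[OF assms, of k i] keep by (auto simp: grim_def split: if_splits)
  then show "k \<in> clean_neighbors i h"
    using link by (simp add: clean_neighbors_def clean_pair_commute)
qed

lemma neighbors_after_removal_grim_eq:
  assumes "d \<in> set_pmf (link_stage grim g h)"
  shows "neighbors (after_removal (net g h) d) i = clean_neighbors i h"
proof
  show "neighbors (after_removal (net g h) d) i \<subseteq> clean_neighbors i h"
    using neighbors_after_removal_grim[of d i "grim i" h] assms by simp
  show "clean_neighbors i h \<subseteq> neighbors (after_removal (net g h) d) i"
  proof
    fix k assume "k \<in> clean_neighbors i h"
    then have link: "{i, k} \<in> net g h" and clean: "clean_pair g i k h"
      by (auto simp: clean_neighbors_def)
    have "{k, i} \<in> net g h"
      using link by (simp add: insert_commute)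
    then have "d (i, k) = Keep" "d (k, i) = Keep"
      using link_stageD[OF assms, of i k] link_stageD[OF assms, of k i] link clean
        clean_pair_commute[where i = i and j = k]
      by (auto simp: grim_def)
    with link show "k \<in> neighbors (after_removal (net g h) d) i"
      by (simp add: neighbors_def in_after_removal_iff)
  qed
qed

lemma expected_value_grim:
  assumes "i \<in> players n"
  shows "measure_pmf.expectation (play_period grim g h) (total_value i) = grim_value i h"
proof -
  have "measure_pmf.expectation nature (\<lambda>\<omega>. measure_pmf.expectation (favor_stage grim g (h, d, \<omega>))
      (total_value i)) = grim_value i h" if "d \<in> set_pmf (link_stage grim g h)" for d
  proof -
    note nb = neighbors_after_removal_grim_eq[OF that, of i]
    then have "clean_pair g i k h" if "{i, k} \<in> after_removal (net g h) d" for k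
      using that by (auto simp: neighbors_def clean_neighbors_def)
    from expectation_favor_stage_grim[OF this] show ?thesis
      using expected_period_value[OF assms, of h d] nb by (simp add: grim_value_def degree_def)
  qed
  then show ?thesis
    unfolding expectation_play_period by (subst expectation_cong_pmf) auto
qed

text \<open>At the link stage a deviation can only shrink the set of clean links, and at the favor
  stage it cannot beat grim play. Since this is true after every history, \<open>grim_value\<close>
  bounds all deviations, not only one-shot ones.\<close>

lemma expected_value_deviation:
  assumes "c - \<gamma> \<le> \<delta> * link_value" and "i \<in> players n"
  shows "measure_pmf.expectation (play_period (grim(i := \<tau>)) g h) (total_value i) \<le> grim_value i h"
  unfolding expectation_play_period
proof (rule expectation_le_const[OF finite_link_stage[OF network]])
  fix d assume d: "d \<in> set_pmf (link_stage (grim(i := \<tau>)) g h)"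
  let ?G = "after_removal (net g h) d"
  note nb = neighbors_after_removal_grim[OF d]
  then have clean: "clean_pair g i k h" if "{i, k} \<in> ?G" for k
    using that by (auto simp: neighbors_def clean_neighbors_def)
  have "measure_pmf.expectation nature (\<lambda>\<omega>. measure_pmf.expectation
        (favor_stage (grim(i := \<tau>)) g (h, d, \<omega>)) (total_value i)) \<le>
      measure_pmf.expectation nature (\<lambda>\<omega>. payoff i (meeting ?G \<omega>) (Some Coop) +
        \<delta> * (link_value * real (degree ?G i)))"
  proof (rule expectation_mono_finite[OF finite_nature[OF n]])
    fix \<omega>
    have "measure_pmf.expectation (favor_stage (grim(i := \<tau>)) g (h, d, \<omega>)) (total_value i) \<le>
        measure_pmf.expectation (favor_stage grim g (h, d, \<omega>)) (total_value i)"
    proof (cases "\<exists>r. meeting ?G \<omega> = Some (r, i)")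
      case True
      then show ?thesis using grim_favor_optimal[OF assms(1)] by blast
    next
      case False
      then show ?thesis by (simp add: favor_stage_deviation)
    qed
    then show "measure_pmf.expectation (favor_stage (grim(i := \<tau>)) g (h, d, \<omega>)) (total_value i) \<le>
        payoff i (meeting ?G \<omega>) (Some Coop) + \<delta> * (link_value * real (degree ?G i))"
      by (simp only: expectation_favor_stage_grim[OF clean])
  qed
  also have "\<dots> = link_value * real (degree ?G i)"
    by (rule expected_period_value[OF assms(2)])
  also have "\<dots> \<le> grim_value i h"
    using link_value_pos card_mono[OF finite_clean_neighbors nb]
    by (simp add: grim_value_def degree_def)
  finally show "measure_pmf.expectation nature (\<lambda>\<omega>. measure_pmf.expectation
      (favor_stage (grim(i := \<tau>)) g (h, d, \<omega>)) (total_value i)) \<le> grim_value i h" .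
qed

lemma discounted_payoff_grim:
  assumes "finite (set_pmf Q)" and "i \<in> players n"
  shows "discounted_payoff grim g i Q = measure_pmf.expectation Q (total_value i)"
  by (rule discounted_payoff_eq[OF assms(1) abs_grim_value_le, where I = "\<lambda>_. True"])
    (simp_all add: expected_value_grim[OF assms(2)])

lemma discounted_payoff_deviation:
  assumes "c - \<gamma> \<le> \<delta> * link_value" and "finite (set_pmf Q)" and "i \<in> players n"
  shows "discounted_payoff (grim(i := \<tau>)) g i Q \<le> measure_pmf.expectation Q (total_value i)"
  using expected_value_deviation[OF assms(1,3)]
  by (rule discounted_payoff_le[OF assms(2) abs_grim_value_le])

section \<open>Grim play as a bilateral equilibrium\<close>

text \<open>Optimality at every node survives averaging over any finitely supported belief. At the
  favor stage the belief must also lie in the information set, so that \<open>i\<close> is the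
  provider at all nodes she considers possible.\<close>

lemma grim_equilibrium:
  assumes cond: "c - \<gamma> \<le> \<delta> * link_value"
  shows "bilateral_equilibrium g grim"
proof -
  obtain \<mu> where consistent: "consistent g grim \<mu>"
    and link: "\<And>t h i. h \<in> link_nodes g t \<Longrightarrow> i \<in> players n \<Longrightarrow>
      finite (set_pmf (link_belief \<mu> i (private_hist g i h)))"
    and favor: "\<And>t h d \<omega> i j. (h, d, \<omega>) \<in> interim_nodes g t \<Longrightarrow>
      meeting (after_removal (net g h) d) \<omega> = Some (j, i) \<Longrightarrow>
      finite (set_pmf (favor_belief \<mu> i (private_hist g i h) (own_links i d) j)) \<and>
      set_pmf (favor_belief \<mu> i (private_hist g i h) (own_links i d) j) \<subseteq>
        favor_info_set g i (private_hist g i h) (own_links i d) j"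
    using consistent_beliefs_exist[OF n network, where \<sigma> = grim] by blast
  have link_opt: "link_payoff (grim(i := \<tau>)) g i B \<le> link_payoff grim g i B"
    if "finite (set_pmf B)" "i \<in> players n" for B i \<tau>
  proof -
    have fin: "finite (set_pmf (bind_pmf B (play_period \<sigma> g)))" for \<sigma>
      using that(1) finite_play_period[OF n network] by simp
    have "link_payoff (grim(i := \<tau>)) g i B \<le>
        measure_pmf.expectation B (\<lambda>h. measure_pmf.expectation (play_period (grim(i := \<tau>)) g h) (total_value i))"
      using discounted_payoff_deviation[OF cond fin that(2)] unfolding link_payoff_def
      by (simp add: expectation_bind_finite[OF that(1) finite_play_period[OF n network]])
    also have "\<dots> \<le> measure_pmf.expectation B (\<lambda>h. measure_pmf.expectation (play_period grim g h) (total_value i))"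
      using expected_value_deviation[OF cond that(2)] expected_value_grim[OF that(2)]
      by (intro expectation_mono_finite[OF that(1)]) simp
    also have "\<dots> = link_payoff grim g i B"
      using discounted_payoff_grim[OF fin that(2)] unfolding link_payoff_def
      by (simp add: expectation_bind_finite[OF that(1) finite_play_period[OF n network]])
    finally show ?thesis .
  qed
  have favor_opt: "favor_payoff (grim(i := \<tau>)) g i B \<le> favor_payoff grim g i B"
    if B: "finite (set_pmf B)" "set_pmf B \<subseteq> favor_info_set g i x y j" and i: "i \<in> players n" for B i j x y \<tau>
  proof -
    have fin: "finite (set_pmf (bind_pmf B (favor_stage \<sigma> g)))" for \<sigma>
      using B(1) finite_favor_stage by simp
    have "favor_payoff (grim(i := \<tau>)) g i B \<le>
        measure_pmf.expectation B (\<lambda>z. measure_pmf.expectation (favor_stage (grim(i := \<tau>)) g z) (total_value i))"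
      using discounted_payoff_deviation[OF cond fin i] unfolding favor_payoff_def
      by (simp add: expectation_bind_finite[OF B(1) finite_favor_stage])
    also have "\<dots> \<le> measure_pmf.expectation B (\<lambda>z. measure_pmf.expectation (favor_stage grim g z) (total_value i))"
    proof (rule expectation_mono_finite[OF B(1)])
      fix z assume "z \<in> set_pmf B"
      with B(2) have z: "z \<in> favor_info_set g i x y j" by blast
      obtain h d \<omega> where zeq: "z = (h, d, \<omega>)" by (cases z)
      with z have "meeting (after_removal (net g h) d) \<omega> = Some (j, i)"
        by (simp add: favor_info_set_def)
      from grim_favor_optimal[OF cond this] zeq
      show "measure_pmf.expectation (favor_stage (grim(i := \<tau>)) g z) (total_value i) \<le>
          measure_pmf.expectation (favor_stage grim g z) (total_value i)" by simp
    qed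
    also have "\<dots> = favor_payoff grim g i B"
      using discounted_payoff_grim[OF fin i] unfolding favor_payoff_def
      by (simp add: expectation_bind_finite[OF B(1) finite_favor_stage])
    finally show ?thesis .
  qed
  have "sequentially_rational g grim \<mu>"
    unfolding sequentially_rational_def Let_def
  proof (intro conjI allI ballI, goal_cases)
    case (1 t h i \<tau>)
    then show ?case using link_opt link by blast
  next
    case (2 t z)
    obtain h d \<omega> where z: "z = (h, d, \<omega>)" by (cases z)
    \<comment> \<open>The favor clause of sequential rationality quantifies over all
      \<open>i\<close>; the link used in the meeting shows that \<open>i\<close> is a
      player.\<close>
    have "i \<in> players n" if "meeting (after_removal (net g h) d) \<omega> = Some (j, i)" for i j
      using network_link_players(2)[OF network_removal] meeting_SomeD(1)[OF that] by blast
    then show ?case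
      unfolding z using favor[OF 2[unfolded z]] by (auto intro!: favor_opt)
  qed
  with consistent grim_measurable show ?thesis
    unfolding bilateral_equilibrium_def sequential_equilibrium_def by blast
qed

corollary stable_if_patient: "c - \<gamma> \<le> \<delta> * link_value \<Longrightarrow> stable g"
  using grim_equilibrium grim_cooperative network by (auto simp: stable_def)

end

section \<open>Cooperative paths and the incentive to defect\<close>

lemma net_all_keep:
  assumes "\<forall>(d, \<omega>, a)\<in>set h. \<forall>i j. d (i, j) = Keep"
  shows "net g h = g"
  using assms
proof (induction h)
  case (Cons q h)
  obtain d \<omega> a where q: "q = (d, \<omega>, a)" by (cases q)
  with Cons.prems have "d = (\<lambda>_. Keep)" by (auto simp: fun_eq_iff)
  with Cons q show ?case by simp
qed simp

text \<open>The three kinds of entries that remain are the ones that can be produced on a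
  cooperative path.\<close>

lemma clean_bilateral_entries:
  assumes "clean (bilateral_hist i k x)" and "e \<in> set (bilateral_hist i k x)"
  shows "e = None \<or> e = Some (i, k, Coop) \<or> e = Some (k, i, Coop)"
proof (cases e)
  case (Some q)
  obtain r s y where q: "q = (r, s, y)" by (cases q)
  have "{r, s} = {i, k}"
    using assms(2) Some q by (auto simp: bilateral_hist_def doubleton_eq_iff split: option.splits if_splits)
  moreover have "y = Coop"
    using assms Some q by (cases y) (auto simp: clean_def)
  ultimately show ?thesis using Some q by (auto simp: doubleton_eq_iff)
qed simp

lemma own_links_keep [simp]: "own_links i (\<lambda>_. Keep) = (\<lambda>_. Keep)"
  by (simp add: own_links_def)

lemma meeting_able [simp]: "{i, k} \<in> g \<Longrightarrow> meeting g (Some (i, k, True)) = Some (i, k)"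
  by (simp add: meeting_def)

lemma meeting_unable [simp]: "meeting g (Some (i, k, False)) = None"
  by (simp add: meeting_def)

context favor_exchange_game
begin

lemma beliefs_limit_favorD:
  assumes "beliefs_limit g M \<mu>" and "(h, d, \<omega>) \<in> interim_nodes g t"
    and "meeting (after_removal (net g h) d) \<omega> = Some (j, i)"
  shows "(\<lambda>m. pmf (favor_belief (M m) i (private_hist g i h) (own_links i d) j) z)
    \<longlonglongrightarrow> pmf (favor_belief \<mu> i (private_hist g i h) (own_links i d) j) z"
  using bspec[OF spec[OF conjunct2[OF assms(1)[unfolded beliefs_limit_def]]] assms(2)] assms(3)
  by (simp add: Let_def del: split_paired_All)

lemma sequentially_rational_favorD:
  assumes "sequentially_rational g \<sigma> \<mu>" and "(h, d, \<omega>) \<in> interim_nodes g t"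
    and "meeting (after_removal (net g h) d) \<omega> = Some (j, i)"
    and "favor_belief \<mu> i (private_hist g i h) (own_links i d) j = B"
  shows "favor_payoff (\<sigma>(i := \<tau>)) g i B \<le> favor_payoff \<sigma> g i B"
  using bspec[OF spec[OF conjunct2[OF assms(1)[unfolded sequentially_rational_def]]] assms(2)] assms(3,4)
  by (simp add: Let_def)

section \<open>Decisions forced on a cooperative path\<close>

text \<open>A demand that causes no meeting in any network; it serves to extend a history by an
  uneventful period.\<close>

lemma unable_in_nature: "Some (1, 1, False) \<in> set_pmf nature"
  using n by (intro set_nature \<alpha> n\<alpha> p) (auto simp: players_def)

lemma able_in_nature: "{i, k} \<in> g \<Longrightarrow> Some (i, k, True) \<in> set_pmf nature"
  using network_link_players[OF network] by (intro set_nature n \<alpha> n\<alpha> p) auto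

lemma cooperative_pathD:
  assumes "cooperative_path g \<sigma>" and "h \<in> set_pmf (run \<sigma> g t [])" and "(d, \<omega>, a) \<in> set h"
  shows "d (i, j) = Keep" and "a \<noteq> Some Defect"
  using assms unfolding cooperative_path_def by blast+

lemma run_SucI:
  assumes "h \<in> set_pmf (run \<sigma> g t [])" and "d \<in> set_pmf (link_stage \<sigma> g h)"
    and "\<omega> \<in> set_pmf nature" and "h' \<in> set_pmf (favor_stage \<sigma> g (h, d, \<omega>))"
  shows "h' \<in> set_pmf (run \<sigma> g (Suc t) [])"
  using assms by (auto simp: play_period_def set_interim_stage)

text \<open>\<open>cooperative_path\<close> speaks of completed periods, so the link decisions are
  first completed by an uneventful demand.\<close>

lemma on_path_link_stage:
  assumes "cooperative_path g \<sigma>" and "h \<in> set_pmf (run \<sigma> g t [])"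
    and "d \<in> set_pmf (link_stage \<sigma> g h)"
  shows "d = (\<lambda>_. Keep)"
proof -
  have run: "(d, Some (1, 1, False), None) # h \<in> set_pmf (run \<sigma> g (Suc t) [])"
    by (rule run_SucI[OF assms(2,3) unable_in_nature]) (simp add: favor_stage_def)
  have "d (i, j) = Keep" for i j
    using cooperative_pathD(1)[OF assms(1) run, of d "Some (1, 1, False)" None] by simp
  then show ?thesis by (simp add: fun_eq_iff)
qed

lemma keep_in_link_stage:
  assumes "cooperative_path g \<sigma>" and "h \<in> set_pmf (run \<sigma> g t [])"
  shows "(\<lambda>_. Keep) \<in> set_pmf (link_stage \<sigma> g h)"
  using on_path_link_stage[OF assms] set_pmf_not_empty[of "link_stage \<sigma> g h"] by blast

lemma net_on_path:
  assumes "cooperative_path g \<sigma>" and "h \<in> set_pmf (run \<sigma> g t [])"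
  shows "net g h = g"
  using cooperative_pathD(1)[OF assms] by (intro net_all_keep) auto

lemma on_path_link_dec:
  assumes path: "cooperative_path g \<sigma>" "h \<in> set_pmf (run \<sigma> g t [])" and link: "{i, j} \<in> g"
  shows "link_dec (\<sigma> i) (private_hist g i h) j = return_pmf Keep"
proof -
  have "a = Keep" if "a \<in> set_pmf (link_dec (\<sigma> i) (private_hist g i h) j)" for a
  proof -
    \<comment> \<open>Link decisions are independent, so any decision in the support of this single
      link combines with \<open>Keep\<close> everywhere else into a profile of positive
      probability.\<close>
    have "(\<lambda>_. Keep)((i, j) := a) \<in> set_pmf (link_stage \<sigma> g h)"
      using that keep_in_link_stage[OF path] link
      unfolding set_link_stage[OF network] net_on_path[OF path] by auto
    from on_path_link_stage[OF path this] show ?thesis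
      by (metis fun_upd_same)
  qed
  then show ?thesis by (simp flip: set_pmf_subset_singleton add: subset_iff)
qed

lemma on_path_favor_dec:
  assumes path: "cooperative_path g \<sigma>" "h \<in> set_pmf (run \<sigma> g t [])" and link: "{r, s} \<in> g"
  shows "favor_dec (\<sigma> s) (private_hist g s h) (\<lambda>_. Keep) r = return_pmf Coop"
proof -
  have "a = Coop" if "a \<in> set_pmf (favor_dec (\<sigma> s) (private_hist g s h) (\<lambda>_. Keep) r)" for a
  proof -
    have run: "((\<lambda>_. Keep), Some (r, s, True), Some a) # h \<in> set_pmf (run \<sigma> g (Suc t) [])"
      by (rule run_SucI[OF path(2) keep_in_link_stage[OF path] able_in_nature[OF link]])
        (simp add: favor_stage_def net_on_path[OF path] link that)
    have "Some a \<noteq> Some Defect"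
      using cooperative_pathD(2)[OF path(1) run, of "\<lambda>_. Keep" "Some (r, s, True)" "Some a"] by simp
    then show ?thesis by (cases a) auto
  qed
  then show ?thesis by (simp flip: set_pmf_subset_singleton add: subset_iff)
qed

text \<open>The record is realized from its oldest entry on: an empty entry by an uneventful demand,
  a favor by the matching able demand, which is met with \<open>Coop\<close> on the path.\<close>

lemma clean_history_on_path:
  assumes "cooperative_path g \<sigma>" and link: "{i, k} \<in> g"
    and "\<And>e. e \<in> set L \<Longrightarrow> e = None \<or> e = Some (i, k, Coop) \<or> e = Some (k, i, Coop)"
  shows "\<exists>h\<in>set_pmf (run \<sigma> g (length L) []). bilateral_hist i k (private_hist g i h) = L"
  using assms(3)
proof (induction L)
  case (Cons e L)
  then obtain h where h: "h \<in> set_pmf (run \<sigma> g (length L) [])"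
    and L: "bilateral_hist i k (private_hist g i h) = L" by auto
  note path = assms(1) h
  note step = run_SucI[OF h keep_in_link_stage[OF path]]
  have link': "{k, i} \<in> g" using link by (simp add: insert_commute)
  consider "e = None" | r s where "e = Some (r, s, Coop)" "{r, s} = {i, k}" "{r, s} \<in> g"
    using Cons.prems[of e] link link' by auto
  then show ?case
  proof cases
    case 1
    have "((\<lambda>_. Keep), Some (1, 1, False), None) # h \<in> set_pmf (run \<sigma> g (Suc (length L)) [])"
      by (rule step[OF unable_in_nature]) (simp add: favor_stage_def)
    with 1 L show ?thesis
      by (intro bexI) (auto simp: pair_entry_def)
  next
    case 2
    have "((\<lambda>_. Keep), Some (r, s, True), Some Coop) # h \<in> set_pmf (run \<sigma> g (Suc (length L)) [])"
      by (rule step[OF able_in_nature[OF 2(3)]])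
        (simp add: favor_stage_def net_on_path[OF path] 2(3) on_path_favor_dec[OF path 2(3)])
    moreover have "bilateral_hist i k (private_hist g i (((\<lambda>_. Keep), Some (r, s, True), Some Coop) # h)) = e # L"
      using L 2(1,2) by (simp add: pair_entry_def net_on_path[OF path] meeting_able[OF 2(3)])
    ultimately show ?thesis by (metis length_Cons)
  qed
qed simp

text \<open>
  A cooperative path realizes every defection-free bilateral history with positive probability, so
  measurability forces cooperation after each of them, on or off the path.
\<close>

lemma cooperative_on_clean:
  assumes path: "cooperative_path g \<sigma>" and meas: "bilaterally_measurable \<sigma>"
    and link: "{i, k} \<in> g" and clean: "clean (bilateral_hist i k x)"
  shows "link_dec (\<sigma> i) x k = return_pmf Keep" and "favor_dec (\<sigma> i) x y k = return_pmf Coop"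
proof -
  obtain h t where h: "h \<in> set_pmf (run \<sigma> g t [])"
    and eq: "bilateral_hist i k (private_hist g i h) = bilateral_hist i k x"
    using clean_history_on_path[OF path link clean_bilateral_entries[OF clean]] by blast
  have "i \<in> players n" "k \<in> players n" "i \<noteq> k"
    using network_link_players[OF network link] by auto
  with meas eq have same: "link_dec (\<sigma> i) x k = link_dec (\<sigma> i) (private_hist g i h) k"
    "favor_dec (\<sigma> i) x y k = favor_dec (\<sigma> i) (private_hist g i h) (\<lambda>_. Keep) k"
    unfolding bilaterally_measurable_def by metis+
  have link': "{k, i} \<in> g" using link by (simp add: insert_commute)
  show "link_dec (\<sigma> i) x k = return_pmf Keep"
    using same on_path_link_dec[OF path h link] by simp
  show "favor_dec (\<sigma> i) x y k = return_pmf Coop"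
    using same on_path_favor_dec[OF path h link'] by simp
qed

section \<open>The value of cooperating with selected neighbors only\<close>

text \<open>Neighbors in \<open>N\<close> see a clean bilateral history forever, whatever happens on
  other links, and so go on cooperating. The lemma prices both sides of the later comparison: the
  equilibrium itself with all neighbors in \<open>N\<close>, and the deviation with one neighbor
  left out.\<close>

lemma selective_cooperation_payoff:
  assumes path: "cooperative_path g \<sigma>" and meas: "bilaterally_measurable \<sigma>"
    and i: "i \<in> players n" and sub: "N \<subseteq> neighbors g i"
    and keep: "\<And>x k. k \<in> N \<Longrightarrow> clean (bilateral_hist i k x) \<Longrightarrow> link_dec \<tau> x k = return_pmf Keep"
    and coop: "\<And>x y k. k \<in> N \<Longrightarrow> clean (bilateral_hist i k x) \<Longrightarrow> favor_dec \<tau> x y k = return_pmf Coop"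
    and drop: "\<And>x k. k \<in> neighbors g i - N \<Longrightarrow> link_dec \<tau> x k = return_pmf Remove"
    and start: "\<And>k. k \<in> N \<Longrightarrow> {i, k} \<in> net g h0 \<and> clean_pair g i k h0"
  shows "discounted_payoff (\<sigma>(i := \<tau>)) g i (return_pmf h0) =
    last_payoff g i h0 + \<delta> * (link_value * real (card N))"
proof -
  let ?\<rho> = "\<sigma>(i := \<tau>)"
  define I where "I h \<longleftrightarrow> (\<forall>k\<in>N. {i, k} \<in> net g h \<and> clean_pair g i k h)" for h
  have N_link: "{i, k} \<in> g" "{k, i} \<in> g" "k \<noteq> i" if "k \<in> N" for k
    using that sub network_link_players(3)[OF network] by (auto simp: neighbors_def insert_commute)
  have nb: "neighbors (after_removal (net g h) d) i = N"
    if I: "I h" and d: "d \<in> set_pmf (link_stage ?\<rho> g h)" for h d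
  proof (intro set_eqI iffI)
    fix k assume "k \<in> neighbors (after_removal (net g h) d) i"
    then have link: "{i, k} \<in> net g h" and "d (i, k) = Keep"
      by (auto simp: neighbors_def in_after_removal_iff)
    moreover have "k \<in> neighbors g i"
      using link net_subset by (auto simp: neighbors_def)
    ultimately show "k \<in> N"
      using link_stageD[OF d link] drop[of k] by (cases "k \<in> N") auto
  next
    fix k assume k: "k \<in> N"
    then have link: "{i, k} \<in> net g h" and clean: "clean_pair g i k h"
      using I by (auto simp: I_def)
    have link': "{k, i} \<in> net g h" using link by (simp add: insert_commute)
    have clean': "clean_pair g k i h" using clean by (subst clean_pair_commute)
    have "d (i, k) = Keep"
      using link_stageD[OF d link] keep[OF k clean] by simp
    moreover have "d (k, i) = Keep"
      using link_stageD[OF d link'] N_link[OF k] cooperative_on_clean(1)[OF path meas _ clean'] by simp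
    ultimately show "k \<in> neighbors (after_removal (net g h) d) i"
      using link by (simp add: neighbors_def in_after_removal_iff)
  qed
  \<comment> \<open>As provider, \<open>i\<close> cooperates by assumption on \<open>\<tau>\<close>;
    as requester, she faces a provider in \<open>N\<close> who follows \<open>\<sigma>\<close> on a
    clean bilateral history.\<close>
  have coop_i: "a = Some Coop"
    if I: "I h" and d: "d \<in> set_pmf (link_stage ?\<rho> g h)"
      and h': "(d, \<omega>, a) # h \<in> set_pmf (favor_stage ?\<rho> g (h, d, \<omega>))"
      and meet: "meeting (after_removal (net g h) d) \<omega> = Some (r, s)" and "i = r \<or> i = s"
    for h d \<omega> a r s
  proof -
    have dec: "a \<in> Some ` set_pmf (favor_dec (?\<rho> s) (private_hist g s h) (own_links s d) r)"
      using h' meet by (auto simp: favor_stage_def)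
    have link: "{r, s} \<in> after_removal (net g h) d"
      using meeting_SomeD(1)[OF meet] .
    show ?thesis
    proof (cases "i = s")
      case True
      then have "r \<in> N"
        using nb[OF I d] link by (auto simp: neighbors_def insert_commute)
      then show ?thesis
        using dec True coop I by (auto simp: I_def)
    next
      case False
      then have r: "i = r" using \<open>i = r \<or> i = s\<close> by simp
      then have s: "s \<in> N"
        using nb[OF I d] link by (auto simp: neighbors_def)
      then have "clean_pair g s i h"
        using I by (subst clean_pair_commute) (simp add: I_def)
      then show ?thesis
        using dec r False N_link[OF s] cooperative_on_clean(2)[OF path meas] by auto
    qed
  qed
  have last: "last_payoff g i h' = payoff i (meeting (after_removal (net g h) d) \<omega>) (Some Coop)"
    if I: "I h" and d: "d \<in> set_pmf (link_stage ?\<rho> g h)"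
      and h': "h' \<in> set_pmf (favor_stage ?\<rho> g (h, d, \<omega>))" for h d \<omega> h'
  proof -
    from h' obtain a where a: "h' = (d, \<omega>, a) # h" by (rule favor_stage_cases)
    show ?thesis
    proof (cases "\<exists>r s. meeting (after_removal (net g h) d) \<omega> = Some (r, s) \<and> (i = r \<or> i = s)")
      case True
      then show ?thesis using coop_i[OF I d] h' a by fastforce
    next
      case False
      then show ?thesis by (auto simp: a payoff_def split: option.split favor_act.split)
    qed
  qed
  \<comment> \<open>The value function is constant, because under the invariant every link stage
    leaves \<open>i\<close> with exactly the links to \<open>N\<close>.\<close>
  have "discounted_payoff ?\<rho> g i (return_pmf h0) =
      measure_pmf.expectation (return_pmf h0) (\<lambda>h. last_payoff g i h + \<delta> * (link_value * real (card N)))"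
  proof (rule discounted_payoff_eq[where I = I])
    fix h assume "h \<in> set_pmf (return_pmf h0)"
    then show "I h" using start by (simp add: I_def)
  next
    fix h h' assume I: "I h" and "h' \<in> set_pmf (play_period ?\<rho> g h)"
    then obtain d \<omega> where d: "d \<in> set_pmf (link_stage ?\<rho> g h)"
      and h': "h' \<in> set_pmf (favor_stage ?\<rho> g (h, d, \<omega>))"
      by (auto simp: play_period_def set_interim_stage)
    from h' obtain a where a: "h' = (d, \<omega>, a) # h" by (rule favor_stage_cases)
    have "{i, k} \<in> net g h' \<and> clean_pair g i k h'" if "k \<in> N" for k
    proof -
      have "{i, k} \<in> after_removal (net g h) d"
        using nb[OF I d] that by (auto simp: neighbors_def)
      moreover have "a = Some Coop" if "meeting (after_removal (net g h) d) \<omega> = Some (r, s)"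
          "i = r \<or> i = s" for r s
        using coop_i[OF I d _ that] h' a by simp
      then have "clean_pair g i k h'"
        unfolding a clean_pair_Cons using I \<open>k \<in> N\<close> by (auto simp: I_def)
      ultimately show ?thesis by (simp add: a)
    qed
    then show "I h'" by (simp add: I_def)
  next
    fix h assume I: "I h"
    have "measure_pmf.expectation (play_period ?\<rho> g h)
        (\<lambda>h'. last_payoff g i h' + \<delta> * (link_value * real (card N))) =
      measure_pmf.expectation (link_stage ?\<rho> g h) (\<lambda>d. link_value * real (card N))"
      unfolding expectation_play_period
    proof (rule expectation_cong_pmf)
      fix d assume d: "d \<in> set_pmf (link_stage ?\<rho> g h)"
      let ?G = "after_removal (net g h) d"
      have "measure_pmf.expectation (favor_stage ?\<rho> g (h, d, \<omega>))
          (\<lambda>h'. last_payoff g i h' + \<delta> * (link_value * real (card N))) =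
        payoff i (meeting ?G \<omega>) (Some Coop) + \<delta> * (link_value * real (card N))" for \<omega>
        by (subst expectation_cong_pmf[where h = "\<lambda>_. payoff i (meeting ?G \<omega>) (Some Coop) +
          \<delta> * (link_value * real (card N))"]) (simp_all add: last[OF I d])
      then show "measure_pmf.expectation nature (\<lambda>\<omega>. measure_pmf.expectation (favor_stage ?\<rho> g (h, d, \<omega>))
          (\<lambda>h'. last_payoff g i h' + \<delta> * (link_value * real (card N)))) = link_value * real (card N)"
        using expected_period_value[OF i, of h d] nb[OF I d] by (simp add: degree_def)
    qed
    then show "measure_pmf.expectation (play_period ?\<rho> g h)
        (\<lambda>h'. last_payoff g i h' + \<delta> * (link_value * real (card N))) = link_value * real (card N)"
      by simp
  qed (auto intro: order_refl)
  then show ?thesis by simp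
qed

section \<open>Beliefs at the first request\<close>

lemma profile_limit_link_stage:
  assumes "profile_limit S \<sigma>"
  shows "(\<lambda>m. pmf (link_stage (S m) g h) d) \<longlonglongrightarrow> pmf (link_stage \<sigma> g h) d"
proof -
  have "i \<in> players n" if "{i, j} \<in> net g h" for i j
    using network_link_players(1)[OF network_net that] .
  then have lim: "(\<lambda>m. pmf (link_dec (S m i) (private_hist g i h) j) a)
      \<longlonglongrightarrow> pmf (link_dec (\<sigma> i) (private_hist g i h) j) a" if "{i, j} \<in> net g h" for i j a
    using assms that unfolding profile_limit_def by blast
  have "(\<lambda>m. \<Prod>q\<in>{(i, j). {i, j} \<in> net g h}. pmf (case q of (i, j) \<Rightarrow>
        link_dec (S m i) (private_hist g i h) j) (d q)) \<longlonglongrightarrow>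
      (\<Prod>q\<in>{(i, j). {i, j} \<in> net g h}. pmf (case q of (i, j) \<Rightarrow>
        link_dec (\<sigma> i) (private_hist g i h) j) (d q))"
    using lim by (intro tendsto_prod) auto
  moreover have "(\<lambda>m. if C then f m else 0) \<longlonglongrightarrow> (if C then l else 0)"
    if "f \<longlonglongrightarrow> l" for C and f :: "nat \<Rightarrow> real" and l
    using that by simp
  ultimately show ?thesis
    unfolding link_stage_def pmf_Pi[OF finite_link_pairs[OF network]] by blast
qed

text \<open>Consistency pins the belief down: along the perturbed profiles \<open>z0\<close> keeps a
  positive limiting probability, while every other node of the information set needs a removal,
  whose probability tends to 0.\<close>

lemma initial_favor_belief:
  assumes path: "cooperative_path g \<sigma>" and cons: "consistent g \<sigma> \<mu>" and link: "{j, i} \<in> g"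
  shows "favor_belief \<mu> i (private_hist g i []) (\<lambda>_. Keep) j =
    return_pmf ([], \<lambda>_. Keep, Some (j, i, True))"
proof -
  define z0 :: interim_node where "z0 = ([], \<lambda>_. Keep, Some (j, i, True))"
  let ?A = "favor_info_set g i (private_hist g i []) (\<lambda>_. Keep) j"
  obtain S where mixed: "\<And>m. completely_mixed (S m)" and S: "profile_limit S \<sigma>"
    and limit: "beliefs_limit g (\<lambda>m. bayes_beliefs g (S m)) \<mu>"
    using cons unfolding consistent_def by blast
  have start: "[] \<in> set_pmf (run \<sigma> g 0 [])" by simp
  have z0_run: "z0 \<in> set_pmf (interim_run \<sigma> g 0)"
    using keep_in_link_stage[OF path start] able_in_nature[OF link]
    by (simp add: interim_run_def bind_return_pmf set_interim_stage z0_def)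
  then have z0_node: "z0 \<in> interim_nodes g 0" by (auto simp: interim_nodes_def)
  have z0_A: "z0 \<in> ?A" using link by (simp add: favor_info_set_def z0_def)
  have pos: "0 < pmf (interim_run (S m) g 0) z0" for m
    using z0_node interim_nodes_mixed[OF network mixed[of m]] by (simp add: pmf_positive)
  have conv: "(\<lambda>m. pmf (interim_run (S m) g 0) ([], d, \<omega>)) \<longlonglongrightarrow> pmf (interim_run \<sigma> g 0) ([], d, \<omega>)" for d \<omega>
    unfolding interim_run_def run.simps bind_return_pmf pmf_interim_stage
    by (intro tendsto_intros profile_limit_link_stage S)
  have ne: "set_pmf (interim_run (S m) g 0) \<inter> ?A \<noteq> {}" for m
    using pos[of m] z0_A by (auto simp: pmf_positive_iff)
  have zero: "pmf (favor_belief \<mu> i (private_hist g i []) (\<lambda>_. Keep) j) z = 0" if "z \<noteq> z0" for z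
  proof -
    let ?b = "\<lambda>m. pmf (cond_pmf (interim_run (S m) g 0) ?A) z"
    have lim: "?b \<longlonglongrightarrow> pmf (favor_belief \<mu> i (private_hist g i []) (\<lambda>_. Keep) j) z"
      using beliefs_limit_favorD[OF limit z0_node[unfolded z0_def], of j i z] link
      by (simp add: bayes_beliefs_def)
    have "?b \<longlonglongrightarrow> 0"
    proof (cases "z \<in> ?A")
      case False
      then show ?thesis by (simp add: pmf_cond[OF ne])
    next
      case True
      obtain h d \<omega> where z: "z = (h, d, \<omega>)" by (cases z)
      have "length h = 0"
        using True z length_private_hist[of g i h] length_private_hist[of g i "[]"]
        by (simp add: favor_info_set_def)
      then have h: "h = []" by simp
      \<comment> \<open>The meeting determines nature's move and the length of the private history
        determines the date, so a node other than \<open>z0\<close> can differ only in the link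
        decisions.\<close>
      have "\<omega> = Some (j, i, True)"
        using True z meeting_SomeD(2) by (auto simp: favor_info_set_def)
      then have "d \<noteq> (\<lambda>_. Keep)"
        using that z h by (simp add: z0_def)
      then have "pmf (interim_run \<sigma> g 0) z = 0"
        using on_path_link_stage[OF path start]
        by (auto simp: z h interim_run_def bind_return_pmf pmf_interim_stage pmf_eq_0_set_pmf)
      moreover have "pmf (interim_run \<sigma> g 0) z0 \<noteq> 0"
        using z0_run by (simp add: set_pmf_iff)
      ultimately have "(\<lambda>m. pmf (interim_run (S m) g 0) z / pmf (interim_run (S m) g 0) z0) \<longlonglongrightarrow> 0"
        using tendsto_divide[OF conv[of d \<omega>] conv[of "\<lambda>_. Keep" "Some (j, i, True)"]]
        by (simp add: z h z0_def)
      moreover have "?b m \<le> pmf (interim_run (S m) g 0) z / pmf (interim_run (S m) g 0) z0" for m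
      proof -
        \<comment> \<open>The information set is at least as likely as \<open>z0\<close>, so
          conditional probabilities are dominated by the ratio to \<open>z0\<close>.\<close>
        have "pmf (interim_run (S m) g 0) z0 \<le> measure_pmf.prob (interim_run (S m) g 0) ?A"
          using z0_A by (auto simp: pmf.rep_eq intro: measure_pmf.finite_measure_mono)
        then show ?thesis
          using pos[of m] True by (simp add: pmf_cond[OF ne] divide_left_mono)
      qed
      ultimately show ?thesis
        by (intro Lim_null_comparison[of ?b]) (auto intro!: always_eventually)
    qed
    with lim show ?thesis by (rule LIMSEQ_unique)
  qed
  have "set_pmf (favor_belief \<mu> i (private_hist g i []) (\<lambda>_. Keep) j) \<subseteq> {z0}"
  proof
    fix z assume "z \<in> set_pmf (favor_belief \<mu> i (private_hist g i []) (\<lambda>_. Keep) j)"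
    then show "z \<in> {z0}"
      using zero[of z] by (cases "z = z0") (simp_all add: set_pmf_iff)
  qed
  then show ?thesis by (simp add: set_pmf_subset_singleton z0_def)
qed

section \<open>Necessity of the patience condition\<close>

text \<open>With \<open>d\<close> links, a request in period 0 gives
  \<open>- c + \<delta> * link_value * d\<close> from complying and
  \<open>- \<gamma> + \<delta> * link_value * (d - 1)\<close> from defecting and dropping the link;
  rationality orders the two.\<close>

lemma link_incentive:
  assumes eq: "bilateral_equilibrium g \<sigma>" and path: "cooperative_path g \<sigma>" and link: "{j, i} \<in> g"
  shows "c - \<gamma> \<le> \<delta> * link_value"
proof -
  obtain \<mu> where meas: "bilaterally_measurable \<sigma>" and rational: "sequentially_rational g \<sigma> \<mu>"
    and cons: "consistent g \<sigma> \<mu>"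
    using eq by (auto simp: bilateral_equilibrium_def sequential_equilibrium_def)
  \<comment> \<open>Unconditional behavior suffices for the deviation, since the links other than
    the one to \<open>j\<close> never see a defection.\<close>
  define \<tau> where "\<tau> = \<lparr>link_dec = (\<lambda>(_ :: private_history) k. return_pmf (if k = j then Remove else Keep)),
    favor_dec = (\<lambda>(_ :: private_history) (_ :: nat \<Rightarrow> link_act) k. return_pmf (if k = j then Defect else Coop))\<rparr>"
  let ?K = "\<lambda>_. Keep" and ?\<omega> = "Some (j, i, True)"
  let ?h = "\<lambda>a. [(?K, ?\<omega>, Some a)] :: history"
  have link': "{i, j} \<in> g" using link by (simp add: insert_commute)
  have i: "i \<in> players n" and ij: "i \<noteq> j"
    using network_link_players[OF network link'] by auto
  have j: "j \<in> neighbors g i" using link' by (simp add: neighbors_def)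
  have start: "[] \<in> set_pmf (run \<sigma> g 0 [])" by simp
  have node: "([], ?K, ?\<omega>) \<in> interim_nodes g 0"
    using keep_in_link_stage[OF path start] able_in_nature[OF link]
    by (force simp: interim_nodes_def interim_run_def bind_return_pmf set_interim_stage)
  have "favor_payoff (\<sigma>(i := \<tau>)) g i (return_pmf ([], ?K, ?\<omega>)) \<le>
      favor_payoff \<sigma> g i (return_pmf ([], ?K, ?\<omega>))"
    by (rule sequentially_rational_favorD[OF rational node])
      (use link initial_favor_belief[OF path cons link] in simp_all)
  \<comment> \<open>The trivial update \<open>\<sigma>(i := \<sigma> i)\<close> casts the
    equilibrium in the form that \<open>selective_cooperation_payoff\<close> evaluates.\<close>
  moreover have "favor_payoff \<sigma> g i (return_pmf ([], ?K, ?\<omega>)) =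
      discounted_payoff (\<sigma>(i := \<sigma> i)) g i (return_pmf (?h Coop))"
    using on_path_favor_dec[OF path start link] link
    by (simp add: favor_payoff_def bind_return_pmf favor_stage_def)
  moreover have "discounted_payoff (\<sigma>(i := \<sigma> i)) g i (return_pmf (?h Coop)) =
      last_payoff g i (?h Coop) + \<delta> * (link_value * real (card (neighbors g i)))"
    by (rule selective_cooperation_payoff[OF path meas i])
      (auto simp: neighbors_def clean_pair_entry cooperative_on_clean[OF path meas])
  moreover have "favor_payoff (\<sigma>(i := \<tau>)) g i (return_pmf ([], ?K, ?\<omega>)) =
      discounted_payoff (\<sigma>(i := \<tau>)) g i (return_pmf (?h Defect))"
    using link by (simp add: favor_payoff_def bind_return_pmf favor_stage_def \<tau>_def)
  moreover have "discounted_payoff (\<sigma>(i := \<tau>)) g i (return_pmf (?h Defect)) =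
      last_payoff g i (?h Defect) + \<delta> * (link_value * real (card (neighbors g i - {j})))"
    using ij link by (intro selective_cooperation_payoff[OF path meas i])
      (auto simp: neighbors_def clean_pair_entry \<tau>_def)
  moreover have "real (card (neighbors g i)) = real (card (neighbors g i - {j})) + 1"
    using card_Suc_Diff1[OF finite_neighbors[OF network] j] by simp
  ultimately show ?thesis
    using ij link by (simp add: payoff_def algebra_simps)
qed

lemma stable_empty_if_impatient:
  assumes "stable g" and "\<delta> * link_value < c - \<gamma>"
  shows "g = {}"
proof (rule ccontr)
  assume "g \<noteq> {}"
  then obtain i j where "{j, i} \<in> g"
    using network unfolding is_network_def complete_network_def by blast
  then show False
    using assms link_incentive unfolding stable_def by force
qed

section \<open>Efficiency, the empty network and the two regimes\<close>

text \<open>Every network is contained in the complete one, which therefore maximizes all degrees at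
  once.\<close>

lemma efficient_complete: "efficient (complete_network n)"
proof -
  have net: "is_network n (complete_network n)" by (simp add: is_network_def)
  have "degree g' i \<le> degree (complete_network n) i" if "is_network n g'" for g' i
    unfolding degree_def using that
    by (intro card_mono finite_neighbors[OF net]) (auto simp: is_network_def neighbors_def)
  moreover have "0 \<le> phat * (v - c)"
    using n \<alpha> p c by (simp add: phat_def)
  ultimately show ?thesis
    using net by (auto simp: efficient_def period_payoff_def mult.assoc intro!: mult_right_mono)
qed

text \<open>Without links nobody ever meets, so all payoffs are 0 and rationality is trivial at
  every level of patience; what remains is the existence of consistent beliefs.\<close>

lemma stable_empty:
  assumes g: "g = {}"
  shows "stable g"
proof -
  have "after_removal (net g h) d = {}" for h d
    using net_subset[of g h] after_removal_subset[of "net g h" d] g by simp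
  then have no_meeting: "meeting (after_removal (net g h) d) \<omega> = None" for h d \<omega>
    by (simp add: meeting_def split: option.split)
  have "last_payoff g i h = 0" for i h
    by (cases h) (auto simp: no_meeting payoff_def)
  then have "last_payoff g i = (\<lambda>_. 0)" for i by (simp add: fun_eq_iff)
  then have "discounted_payoff \<sigma> g i Q = 0" for \<sigma> i Q
    by (simp add: discounted_payoff_def)
  then have "sequentially_rational g grim \<mu>" for \<mu>
    by (auto simp: sequentially_rational_def link_payoff_def no_meeting)
  moreover obtain \<mu> where "consistent g grim \<mu>"
    using consistent_beliefs_exist[OF n network] .
  ultimately show ?thesis
    using network grim_measurable grim_cooperative
    by (auto simp: stable_def bilateral_equilibrium_def sequential_equilibrium_def)
qed

end

theorem proposition5:
  fixes n :: nat and \<alpha> p \<delta> v c \<gamma> phat :: real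
  assumes "n \<ge> 1"
    and "0 < \<alpha>" and "\<alpha> \<le> 1" and "real n * \<alpha> \<le> 1"
    and "0 < p" and "p < 1"
    and "0 < \<delta>" and "\<delta> < 1"
    and "0 < c" and "c < v"
    and "0 \<le> \<gamma>" and "\<gamma> < c"
    and "phat = \<alpha> * p / real n"
  shows "(c - \<gamma> \<le> \<delta> / (1 - \<delta>) * phat * (v - c) \<longrightarrow>
      favor_exchange.stable n \<alpha> p \<delta> v c \<gamma> (complete_network n) \<and>
      favor_exchange.efficient n \<alpha> p v c (complete_network n)) \<and>
    (c - \<gamma> > \<delta> / (1 - \<delta>) * phat * (v - c) \<longrightarrow>
      (\<forall>g. favor_exchange.stable n \<alpha> p \<delta> v c \<gamma> g \<longleftrightarrow> g = {}))"
proof -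
  have game: "favor_exchange_game n \<alpha> p \<delta> v c \<gamma> g" if "is_network n g" for g
    using assms that by unfold_locales
  interpret complete: favor_exchange_game n \<alpha> p \<delta> v c \<gamma> "complete_network n"
    by (rule game) (simp add: is_network_def)
  have "complete.phat = phat"
    using assms by (simp add: complete.phat_def)
  then have threshold: "\<delta> * complete.link_value = \<delta> / (1 - \<delta>) * phat * (v - c)"
    by (simp add: complete.link_value_def)
  have "complete.stable g \<longleftrightarrow> g = {}" if "\<delta> * complete.link_value < c - \<gamma>" for g
  proof
    assume "complete.stable g"
    \<comment> \<open>Stability includes being a network, so the locale can be instantiated at the
      arbitrary \<open>g\<close>.\<close>
    then interpret favor_exchange_game n \<alpha> p \<delta> v c \<gamma> g
      by (intro game) (simp add: complete.stable_def)
    show "g = {}"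
      using \<open>complete.stable g\<close> that by (rule stable_empty_if_impatient)
  next
    assume "g = {}"
    then interpret favor_exchange_game n \<alpha> p \<delta> v c \<gamma> g
      by (intro game) (simp add: is_network_def)
    show "complete.stable g" using \<open>g = {}\<close> by (rule stable_empty)
  qed
  then show ?thesis
    using complete.stable_if_patient complete.efficient_complete unfolding threshold by simp
qed

end
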